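(* Let $A$ be a finite abelian group with $|A|\ge 3$, let $f$ be an automorphism of $A$ of order $2$, let $y\in A$ satisfy $f(y)=y$, let $G=\langle A, x \mid x^2=y,\ xax^{-1}=f(a)\ (a\in A)\rangle$, and let $B=\{f(a)a^{-1}: a\in A\}$, with index $(A:B)$ in $A$. Then $G$ has exactly $2(A:B)+(|A|-(A:B))/2$ pairwise inequivalent irreducible representations $\rho_1,\dots,\rho_{2(A:B)+(|A|-(A:B))/2}$, and they can be taken as follows. (1) Let $\pi_1,\dots,\pi_{(A:B)}$ be the pairwise inequivalent irreducible representations of $A/B$. For $j\in\{1,\dots,(A:B)\}$, $\rho_j$ and $\rho_{j+(A:B)}$ are the one-dimensional representations of $G$ given by $\rho_j(x)=\sqrt{\pi_j(\overline{y})}$, $\rho_j(a)=\pi_j(\overline{a})$ for $a\in A$, and $\rho_{j+(A:B)}(x)=-\sqrt{\pi_j(\overline{y})}$, $\rho_{j+(A:B)}(a)=\pi_j(\overline{a})$ for $a\in A$, where $\overline{a}$ denotes the class of $a\in A$ modulo $B$ and $\sqrt{\pi_j(\overline{y})}$ is a fixed square root of $\pi_j(\overline{y})$ in $\mathbb{C}$. (2) Let $\psi_1,\dots,\psi_{|A|-(A:B)}$ be the pairwise inequivalent irreducible representations of $A$ whose kernels do not contain $B$, indexed so that $\psi_{j+(|A|-(A:B))/2}=\psi_j\circ f$ for $j\in\{1,\dots,(|A|-(A:B))/2\}$. Then for $j\in\{1,\dots,(|A|-(A:B))/2\}$ and $a\in A$, $\rho_{2(A:B)+j}(a)=\begin{pmatrix}\psi_j(a)&0\\0&\psi_j(f(a))\end{pmatrix}$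 and $\rho_{2(A:B)+j}(xa)=\begin{pmatrix}0&\psi_j(yf(a))\\ \psi_j(a)&0\end{pmatrix}$.
   Context: The presentation means $G$ is generated by $A$ and an element $x$ subject to the relations of $A$ together with $x^2=y$ and $xax^{-1}=f(a)$ for all $a\in A$; $G$ is the disjoint union of $A$ and $xA$, and $|G|=2|A|$. Representations are complex representations; irreducible representations of an abelian group are one-dimensional. *)

theory Defs
  imports
    "HOL-Algebra.Bij"
    "HOL-Algebra.Multiplicative_Group"
    "Jordan_Normal_Form.VS_Connect"
begin

section \<open>Groups given by generators and relators\<close>

text \<open>A letter \<open>(s, True)\<close> stands for the generator \<open>s\<close>, and \<open>(s, False)\<close> for its inverse.\<close>

type_synonym 's gword = "('s \<times> bool) list"

definition gwords :: "'s set \<Rightarrow> 's gword set" where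
  "gwords S = lists (S \<times> UNIV)"

text \<open>The least congruence on words that makes \<open>s s\<inverse>\<close>, \<open>s\<inverse> s\<close> and all
  relators trivial: the classes are the elements of the free group on \<open>S\<close> modulo the normal
  closure of \<open>R\<close>.\<close>

inductive_set pres_rel :: "'s set \<Rightarrow> 's gword set \<Rightarrow> ('s gword \<times> 's gword) set"
  for S :: "'s set" and R :: "'s gword set" where
  pres_refl: "w \<in> gwords S \<Longrightarrow> (w, w) \<in> pres_rel S R"
| pres_sym: "(v, w) \<in> pres_rel S R \<Longrightarrow> (w, v) \<in> pres_rel S R"
| pres_trans: "(u, v) \<in> pres_rel S R \<Longrightarrow> (v, w) \<in> pres_rel S R \<Longrightarrow> (u, w) \<in> pres_rel S R"
| pres_cancel: "u \<in> gwords S \<Longrightarrow> v \<in> gwords S \<Longrightarrow> s \<in> S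
    \<Longrightarrow> (u @ [(s, b), (s, \<not> b)] @ v, u @ v) \<in> pres_rel S R"
| pres_relator: "u \<in> gwords S \<Longrightarrow> v \<in> gwords S \<Longrightarrow> r \<in> R \<Longrightarrow> r \<in> gwords S
    \<Longrightarrow> (u @ r @ v, u @ v) \<in> pres_rel S R"

definition pres_group :: "'s set \<Rightarrow> 's gword set \<Rightarrow> 's gword set monoid" where
  "pres_group S R =
     \<lparr>carrier = gwords S // pres_rel S R,
      mult = (\<lambda>U V. \<Union>u\<in>U. \<Union>v\<in>V. pres_rel S R `` {u @ v}),
      one = pres_rel S R `` {[]}\<rparr>"

definition pres_gen :: "'s set \<Rightarrow> 's gword set \<Rightarrow> 's \<Rightarrow> 's gword set" where
  "pres_gen S R s = pres_rel S R `` {[(s, True)]}"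

lemma equiv_pres_rel: "equiv (gwords S) (pres_rel S R)"
proof -
  have "v \<in> gwords S \<and> w \<in> gwords S" if "(v, w) \<in> pres_rel S R" for v w
    using that by induction (auto simp: gwords_def)
  then show ?thesis
    by (auto intro!: equivI refl_onI symI transI intro: pres_refl pres_sym pres_trans)
qed

lemma pres_rel_context:
  assumes "(v, w) \<in> pres_rel S R" "p \<in> gwords S" "q \<in> gwords S"
  shows "(p @ v @ q, p @ w @ q) \<in> pres_rel S R"
  using assms
proof induction
  case (pres_refl w)
  then show ?case by (auto intro!: pres_rel.pres_refl simp: gwords_def)
next
  case (pres_sym v w)
  then show ?case by (auto intro: pres_rel.pres_sym)
next
  case (pres_trans u v w)
  then show ?case by (auto intro: pres_rel.pres_trans)
next
  case (pres_cancel u v s b)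
  then show ?case
    using pres_rel.pres_cancel[of "p @ u" S "v @ q" s b R] by (auto simp: gwords_def)
next
  case (pres_relator u v r)
  then show ?case
    using pres_rel.pres_relator[of "p @ u" S "v @ q" r R] by (auto simp: gwords_def)
qed

lemma pres_group_mult:
  assumes "u \<in> gwords S" "v \<in> gwords S"
  shows "pres_rel S R `` {u} \<otimes>\<^bsub>pres_group S R\<^esub> pres_rel S R `` {v} = pres_rel S R `` {u @ v}"
proof -
  have "congruent2 (pres_rel S R) (pres_rel S R) (\<lambda>u v. pres_rel S R `` {u @ v})"
  proof (rule congruent2I[OF equiv_pres_rel equiv_pres_rel])
    fix y z w assume 1: "w \<in> gwords S" "(y, z) \<in> pres_rel S R"
    show "pres_rel S R `` {y @ w} = pres_rel S R `` {z @ w}"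
      using pres_rel_context[OF 1(2), of "[]" w] 1
      by (intro equiv_class_eq[OF equiv_pres_rel]) (auto simp: gwords_def)
    show "pres_rel S R `` {w @ y} = pres_rel S R `` {w @ z}"
      using pres_rel_context[OF 1(2), of w "[]"] 1
      by (intro equiv_class_eq[OF equiv_pres_rel]) (auto simp: gwords_def)
  qed
  from UN_equiv_class2[OF equiv_pres_rel equiv_pres_rel this assms]
  show ?thesis by (simp add: pres_group_def)
qed

lemma group_pres_group: "group (pres_group S R)"
proof -
  let ?C = "\<lambda>w. pres_rel S R `` {w}"
  have car: "carrier (pres_group S R) = ?C ` gwords S"
    by (auto simp: pres_group_def quotient_def)
  have one: "\<one>\<^bsub>pres_group S R\<^esub> = ?C []" by (simp add: pres_group_def)
  have [simp]: "[] \<in> gwords S" by (simp add: gwords_def)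
  have app [simp]: "u @ v \<in> gwords S" if "u \<in> gwords S" "v \<in> gwords S" for u v
    using that by (auto simp: gwords_def)
  have inv: "\<exists>v\<in>gwords S. ?C (v @ w) = ?C []" if "w \<in> gwords S" for w
    using that
  proof (induction w)
    case Nil
    then show ?case by (intro bexI[of _ "[]"]) auto
  next
    case (Cons l w)
    obtain s b where l: "l = (s, b)" by (cases l)
    from Cons.prems l have s: "s \<in> S" and w: "w \<in> gwords S" by (auto simp: gwords_def)
    from Cons.IH[OF w] obtain v where v: "v \<in> gwords S" "?C (v @ w) = ?C []" by blast
    have "(v @ [(s, \<not> b), (s, \<not> \<not> b)] @ w, v @ w) \<in> pres_rel S R"
      by (rule pres_cancel[OF v(1) w s])
    then have "?C ((v @ [(s, \<not> b)]) @ l # w) = ?C (v @ w)"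
      using l by (intro equiv_class_eq[OF equiv_pres_rel]) simp
    moreover have "v @ [(s, \<not> b)] \<in> gwords S" using v s by (auto simp: gwords_def)
    ultimately show ?case using v(2) by blast
  qed
  show ?thesis
  proof (rule groupI)
    fix x assume "x \<in> carrier (pres_group S R)"
    then obtain w where w: "w \<in> gwords S" "x = ?C w" by (auto simp: car)
    from inv[OF w(1)] obtain v where "v \<in> gwords S" "?C (v @ w) = ?C []" by blast
    then show "\<exists>y\<in>carrier (pres_group S R). y \<otimes>\<^bsub>pres_group S R\<^esub> x = \<one>\<^bsub>pres_group S R\<^esub>"
      using w by (intro bexI[of _ "?C v"]) (auto simp: car one pres_group_mult)
  qed (auto simp: car one pres_group_mult)
qed

section \<open>The extension of an abelian group by one generator\<close>

datatype 'a ext_letter = Base 'a | Ext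

text \<open>The first set is the multiplication table of \<open>A\<close>; the others encode
  \<open>x\<^sup>2 = y\<close> and \<open>x a x\<inverse> = f a\<close>.\<close>

definition ext_relators ::
  "('a, 'm) monoid_scheme \<Rightarrow> ('a \<Rightarrow> 'a) \<Rightarrow> 'a \<Rightarrow> 'a ext_letter gword set" where
  "ext_relators A f y =
     {[(Base a, True), (Base b, True), (Base (a \<otimes>\<^bsub>A\<^esub> b), False)] | a b.
        a \<in> carrier A \<and> b \<in> carrier A}
   \<union> {[(Ext, True), (Ext, True), (Base y, False)]}
   \<union> {[(Ext, True), (Base a, True), (Ext, False), (Base (f a), False)] | a. a \<in> carrier A}"

definition ext_letters :: "('a, 'm) monoid_scheme \<Rightarrow> 'a ext_letter set" where
  "ext_letters A = insert Ext (Base ` carrier A)"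

definition ext_group ::
  "('a, 'm) monoid_scheme \<Rightarrow> ('a \<Rightarrow> 'a) \<Rightarrow> 'a \<Rightarrow> 'a ext_letter gword set monoid" where
  "ext_group A f y = pres_group (ext_letters A) (ext_relators A f y)"

definition ext_base ::
  "('a, 'm) monoid_scheme \<Rightarrow> ('a \<Rightarrow> 'a) \<Rightarrow> 'a \<Rightarrow> 'a \<Rightarrow> 'a ext_letter gword set" where
  "ext_base A f y a = pres_gen (ext_letters A) (ext_relators A f y) (Base a)"

definition ext_elem ::
  "('a, 'm) monoid_scheme \<Rightarrow> ('a \<Rightarrow> 'a) \<Rightarrow> 'a \<Rightarrow> 'a ext_letter gword set" where
  "ext_elem A f y = pres_gen (ext_letters A) (ext_relators A f y) Ext"

section \<open>Complex matrix representations\<close>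

definition GLC :: "nat \<Rightarrow> complex mat monoid" where
  "GLC n = units_of (ring_mat TYPE(complex) n ())"

definition is_rep :: "('g, 'm) monoid_scheme \<Rightarrow> nat \<Rightarrow> ('g \<Rightarrow> complex mat) \<Rightarrow> bool" where
  "is_rep G n \<rho> \<longleftrightarrow> \<rho> \<in> hom G (GLC n)"

definition is_irrep :: "('g, 'm) monoid_scheme \<Rightarrow> nat \<Rightarrow> ('g \<Rightarrow> complex mat) \<Rightarrow> bool" where
  "is_irrep G n \<rho> \<longleftrightarrow> is_rep G n \<rho> \<and> n > 0 \<and>
     (\<forall>W. VectorSpace.subspace class_ring W (module_vec TYPE(complex) n) \<longrightarrow>
          (\<forall>g\<in>carrier G. \<forall>w\<in>W. \<rho> g *\<^sub>v w \<in> W) \<longrightarrow>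
          W = {0\<^sub>v n} \<or> W = carrier_vec n)"

definition irreps :: "('g, 'm) monoid_scheme \<Rightarrow> ('g \<Rightarrow> complex mat) set" where
  "irreps G = {\<rho>. \<exists>n. is_irrep G n \<rho>}"

definition equiv_rep ::
  "('g, 'm) monoid_scheme \<Rightarrow> ('g \<Rightarrow> complex mat) \<Rightarrow> ('g \<Rightarrow> complex mat) \<Rightarrow> bool" where
  "equiv_rep G \<rho> \<sigma> \<longleftrightarrow>
     (\<exists>n. is_rep G n \<rho> \<and> is_rep G n \<sigma> \<and>
        (\<exists>P\<in>carrier (GLC n). \<forall>g\<in>carrier G. P * \<rho> g = \<sigma> g * P))"

text \<open>\<open>\<rho> 1, \<dots>, \<rho> N\<close> are, up to equivalence and without repetition, all the
  representations of \<open>G\<close> that belong to \<open>C\<close>.\<close>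

definition enumerates_reps ::
  "('g, 'm) monoid_scheme \<Rightarrow> ('g \<Rightarrow> complex mat) set \<Rightarrow> nat
     \<Rightarrow> (nat \<Rightarrow> 'g \<Rightarrow> complex mat) \<Rightarrow> bool" where
  "enumerates_reps G C N \<rho> \<longleftrightarrow>
     (\<forall>j\<in>{1..N}. \<rho> j \<in> C) \<and>
     (\<forall>i\<in>{1..N}. \<forall>j\<in>{1..N}. i \<noteq> j \<longrightarrow> \<not> equiv_rep G (\<rho> i) (\<rho> j)) \<and>
     (\<forall>\<sigma>\<in>C. \<exists>j\<in>{1..N}. equiv_rep G \<sigma> (\<rho> j))"

definition irreps_ker_not_containing ::
  "('g, 'm) monoid_scheme \<Rightarrow> 'g set \<Rightarrow> ('g \<Rightarrow> complex mat) set" where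
  "irreps_ker_not_containing G B =
     {\<sigma>. \<exists>n. is_irrep G n \<sigma> \<and> \<not> B \<subseteq> kernel G (GLC n) \<sigma>}"

text \<open>One-dimensional representations take values in 1 by 1 matrices; these two functions pass
  between such matrices and scalars.\<close>

definition mat1 :: "complex \<Rightarrow> complex mat" where
  "mat1 c = mat_of_rows_list 1 [[c]]"

definition entry1 :: "complex mat \<Rightarrow> complex" where
  "entry1 M = M $$ (0, 0)"

end

theory Submission
  imports Defs
begin

text \<open>Restrict an irreducible representation of \<open>G\<close> to \<open>A\<close> and pick a common eigenvector \<open>v\<close>,
  with character \<open>\<chi>\<close>.  Then \<open>x v\<close> is an eigenvector with character \<open>\<chi> \<circ> f\<close>, and
  \<open>\<chi> \<circ> f = \<chi>\<close> holds iff \<open>\<chi>\<close> is trivial on \<open>B\<close>.  If \<open>\<chi> \<circ> f = \<chi>\<close> and \<open>t\<^sup>2 = \<chi> y\<close>, either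
  \<open>x v + t v\<close> or \<open>v\<close> spans an invariant line, on which \<open>x\<close> acts as \<open>t\<close> or \<open>- t\<close>; otherwise
  \<open>v\<close> and \<open>x v\<close> span a copy of the two-dimensional representation attached to \<open>\<chi>\<close>.  Schur's
  lemma turns these into equivalences.  The numbers come from \<open>A\<close> having \<open>|A|\<close> characters, of
  which \<open>(A:B)\<close> are trivial on \<open>B\<close>; on the others \<open>\<chi> \<mapsto> \<chi> \<circ> f\<close> is an involution without
  fixed points.\<close>

section \<open>Characters of finite abelian groups\<close>

definition characters :: "('g, 'm) monoid_scheme \<Rightarrow> ('g \<Rightarrow> complex) set" where
  "characters G = hom G (mult_of class_ring) \<inter> extensional (carrier G)"

lemma character_mult:
  "\<chi> \<in> characters G \<Longrightarrow> a \<in> carrier G \<Longrightarrow> b \<in> carrier G \<Longrightarrow> \<chi> (a \<otimes>\<^bsub>G\<^esub> b) = \<chi> a * \<chi> b"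
  by (simp add: characters_def hom_def)

lemma character_nonzero: "\<chi> \<in> characters G \<Longrightarrow> a \<in> carrier G \<Longrightarrow> \<chi> a \<noteq> 0"
  by (auto simp: characters_def hom_def)

lemma character_eqI:
  "\<chi> \<in> characters G \<Longrightarrow> \<psi> \<in> characters G \<Longrightarrow> (\<And>a. a \<in> carrier G \<Longrightarrow> \<chi> a = \<psi> a) \<Longrightarrow> \<chi> = \<psi>"
  unfolding characters_def by (blast intro: extensionalityI)

lemma (in group) character_one:
  assumes "\<chi> \<in> characters G"
  shows "\<chi> \<one> = 1"
  using character_mult[OF assms one_closed one_closed] character_nonzero[OF assms one_closed]
  by simp

lemma (in group) character_inv:
  assumes \<chi>: "\<chi> \<in> characters G" and a: "a \<in> carrier G"
  shows "\<chi> (inv a) = inverse (\<chi> a)"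
proof -
  have "\<chi> a * \<chi> (inv a) = 1"
    using character_mult[OF \<chi>, of a "inv a"] a by (simp add: character_one[OF \<chi>])
  then show ?thesis by (rule inverse_unique[symmetric])
qed

lemma (in group) character_pow:
  assumes "\<chi> \<in> characters G" "a \<in> carrier G"
  shows "\<chi> (a [^] (n::nat)) = \<chi> a ^ n"
  using assms by (induction n) (simp_all add: character_one character_mult)

lemma (in group) characters_iff:
  "\<chi> \<in> characters G \<longleftrightarrow> \<chi> \<in> extensional (carrier G) \<and> \<chi> \<one> = 1 \<and>
     (\<forall>a\<in>carrier G. \<forall>b\<in>carrier G. \<chi> (a \<otimes> b) = \<chi> a * \<chi> b)"
proof
  assume \<chi>: "\<chi> \<in> extensional (carrier G) \<and> \<chi> \<one> = 1 \<and>
     (\<forall>a\<in>carrier G. \<forall>b\<in>carrier G. \<chi> (a \<otimes> b) = \<chi> a * \<chi> b)"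
  have "\<chi> a \<noteq> 0" if "a \<in> carrier G" for a
    using \<chi> that r_inv[OF that] inv_closed[OF that] by (metis mult_zero_left zero_neq_one)
  with \<chi> show "\<chi> \<in> characters G" by (auto simp: characters_def hom_def)
qed (auto simp: character_one character_mult, simp add: characters_def)

lemma (in group) finite_characters:
  assumes "finite (carrier G)"
  shows "finite (characters G)"
proof (rule finite_subset)
  show "characters G \<subseteq> carrier G \<rightarrow>\<^sub>E {z. z ^ Coset.order G = 1}"
  proof (intro subsetI PiE_I)
    fix \<chi> a assume "\<chi> \<in> characters G" "a \<in> carrier G"
    then show "\<chi> a \<in> {z. z ^ Coset.order G = 1}"
      using character_pow[of \<chi> a "Coset.order G"] by (simp add: pow_order_eq_1 character_one)
  qed (auto simp: characters_def extensional_def)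
  show "finite (carrier G \<rightarrow>\<^sub>E {z::complex. z ^ Coset.order G = 1})"
    using assms
    by (intro finite_PiE finite_roots_unity) (auto simp: order_gt_0_iff_finite Suc_le_eq)
qed

lemma (in group) sum_nontrivial_character:
  assumes \<chi>: "\<chi> \<in> characters G" and nontrivial: "\<chi> \<noteq> (\<lambda>a\<in>carrier G. 1)"
  shows "(\<Sum>a\<in>carrier G. \<chi> a) = 0"
proof -
  obtain c where c: "c \<in> carrier G" "\<chi> c \<noteq> 1"
    using nontrivial \<chi> unfolding characters_def
    by (metis (mono_tags, lifting) IntD2 extensionalityI restrict_apply' restrict_extensional)
  have "bij_betw (\<lambda>a. c \<otimes> a) (carrier G) (carrier G)"
    using c(1) by (intro bij_betwI[where g = "\<lambda>a. inv c \<otimes> a"]) (auto simp: m_assoc[symmetric])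
  then have "(\<Sum>a\<in>carrier G. \<chi> a) = (\<Sum>a\<in>carrier G. \<chi> (c \<otimes> a))"
    by (rule sum.reindex_bij_betw[symmetric])
  also have "\<dots> = \<chi> c * (\<Sum>a\<in>carrier G. \<chi> a)"
    using c(1) by (simp add: sum_distrib_left character_mult[OF \<chi>])
  finally show ?thesis using c(2) by simp
qed

subsection \<open>Translation-invariant function spaces\<close>

text \<open>The second argument of a function indexes the coordinates of its vector values, so that one
  statement covers scalar functions and the coefficients \<open>(\<rho> g v)\<^sub>i\<close> of a representation.\<close>

definition (in monoid) translation_invariant :: "('a \<Rightarrow> 'i \<Rightarrow> complex) set \<Rightarrow> bool" where
  "translation_invariant V \<longleftrightarrow>
     (\<forall>F\<in>V. \<forall>F'\<in>V. (\<lambda>b i. F b i + F' b i) \<in> V) \<and>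
     (\<forall>c. \<forall>F\<in>V. (\<lambda>b i. c * F b i) \<in> V) \<and>
     (\<forall>a\<in>carrier G. \<forall>F\<in>V. (\<lambda>b. F (a \<otimes> b)) \<in> V)"

definition (in monoid) common_eigenfunction :: "'a set \<Rightarrow> ('a \<Rightarrow> 'i \<Rightarrow> complex) \<Rightarrow> bool" where
  "common_eigenfunction S F \<longleftrightarrow>
     (\<exists>b\<in>carrier G. \<exists>i. F b i \<noteq> 0) \<and>
     (\<forall>a\<in>S. \<exists>\<kappa>. \<forall>b\<in>carrier G. \<forall>i. F (a \<otimes> b) i = \<kappa> * F b i)"

text \<open>Translations commute and have finite order, so projecting onto one eigenspace after another
  produces a common eigenfunction; every common eigenfunction is proportional to a character.\<close>

definition (in monoid) eigenprojection ::
  "'a \<Rightarrow> complex \<Rightarrow> ('a \<Rightarrow> 'i \<Rightarrow> complex) \<Rightarrow> 'a \<Rightarrow> 'i \<Rightarrow> complex" where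
  "eigenprojection c \<mu> F b i = (\<Sum>k<Coset.order G. F (c [^] k \<otimes> b) i * \<mu> ^ k)"

lemma (in group) eigenprojection_in_invariant:
  assumes V: "translation_invariant V" and F: "F \<in> V" and c: "c \<in> carrier G"
  shows "eigenprojection c \<mu> F \<in> V"
proof -
  have add: "\<And>H H'. H \<in> V \<Longrightarrow> H' \<in> V \<Longrightarrow> (\<lambda>b i. H b i + H' b i) \<in> V"
    and scale: "\<And>z H. H \<in> V \<Longrightarrow> (\<lambda>b i. z * H b i) \<in> V"
    and translate: "\<And>k. (\<lambda>b. F (c [^] (k::nat) \<otimes> b)) \<in> V"
    using V F c by (auto simp: translation_invariant_def)
  have "(\<lambda>b i. \<Sum>k<n. F (c [^] k \<otimes> b) i * \<mu> ^ k) \<in> V" for n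
  proof (induction n)
    case 0
    show ?case using scale[OF F, of 0] by simp
  next
    case (Suc n)
    then show ?case
      using add[OF Suc.IH scale[OF translate, of "\<mu> ^ n" n]] by (simp add: mult.commute)
  qed
  then show ?thesis unfolding eigenprojection_def[abs_def] .
qed

lemma (in group) eigenprojection_translate:
  assumes "finite (carrier G)" "c \<in> carrier G" "b \<in> carrier G" "\<mu> ^ Coset.order G = 1"
  shows "eigenprojection c \<mu> F (c \<otimes> b) i = inverse \<mu> * eigenprojection c \<mu> F b i"
proof -
  let ?N = "Coset.order G"
  let ?g = "\<lambda>k. F (c [^] k \<otimes> b) i * \<mu> ^ k"
  have \<mu>: "\<mu> \<noteq> 0" using assms(1,4) by (auto simp: power_0_left order_gt_0_iff_finite[symmetric])
  have "c [^] k \<otimes> (c \<otimes> b) = c [^] Suc k \<otimes> b" for k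
    using assms by (simp add: m_assoc)
  then have "\<mu> * eigenprojection c \<mu> F (c \<otimes> b) i = (\<Sum>k<?N. ?g (Suc k))"
    by (simp add: eigenprojection_def sum_distrib_left mult.left_commute)
  also have "?g ?N = ?g 0"
    using assms pow_order_eq_1[of c] by simp
  then have "(\<Sum>k<?N. ?g (Suc k)) = (\<Sum>k<?N. ?g k)"
    using sum.lessThan_Suc_shift[of ?g ?N] sum.lessThan_Suc[of ?g ?N] by simp
  finally show ?thesis using \<mu> by (simp add: eigenprojection_def field_simps)
qed

lemma (in comm_group) eigenprojection_commute:
  assumes "c \<in> carrier G" "d \<in> carrier G" "b \<in> carrier G"
    and F: "\<And>b i. b \<in> carrier G \<Longrightarrow> F (d \<otimes> b) i = \<kappa> * F b i"
  shows "eigenprojection c \<mu> F (d \<otimes> b) i = \<kappa> * eigenprojection c \<mu> F b i"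
proof -
  have "F (c [^] k \<otimes> (d \<otimes> b)) i = \<kappa> * F (c [^] k \<otimes> b) i" for k :: nat
    using assms F[of "c [^] k \<otimes> b" i] m_lcomm[of "c [^] k" d b] by simp
  then show ?thesis
    by (simp add: eigenprojection_def sum_distrib_left mult.assoc)
qed

lemma ex_root_of_unity_poly_nonzero:
  fixes c :: "nat \<Rightarrow> complex"
  assumes "k < N" "c k \<noteq> 0"
  shows "\<exists>z. z ^ N = 1 \<and> (\<Sum>i<N. c i * z ^ i) \<noteq> 0"
proof (rule ccontr)
  assume no_root: "\<not> ?thesis"
  obtain n where n: "N = Suc n" using assms(1) by (cases N) auto
  let ?zeros = "{z. (\<Sum>i\<le>n. c i * z ^ i) = 0}"
  have "finite ?zeros" "card ?zeros \<le> n"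
    using polyfun_rootbound[of c k n] assms n by auto
  moreover have "{z. z ^ N = 1} \<subseteq> ?zeros"
    using no_root by (auto simp: n lessThan_Suc_atMost)
  ultimately have "card {z::complex. z ^ N = 1} \<le> n"
    using card_mono le_trans by blast
  then show False using card_roots_unity_eq[of N] n by simp
qed

lemma (in comm_group) common_eigenfunction_exists:
  assumes fin: "finite (carrier G)" and V: "translation_invariant V"
    and F: "F \<in> V" "b \<in> carrier G" "F b i \<noteq> 0"
    and S: "finite S" "S \<subseteq> carrier G"
  shows "\<exists>F\<in>V. common_eigenfunction S F"
  using S
proof (induction S rule: finite_induct)
  case empty
  then show ?case using F by (intro bexI[of _ F]) (auto simp: common_eigenfunction_def)
next
  case (insert c S)
  then have c: "c \<in> carrier G" and S: "S \<subseteq> carrier G" by auto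
  from insert obtain H where H: "H \<in> V" "common_eigenfunction S H" by blast
  then obtain b i where bi: "b \<in> carrier G" "H b i \<noteq> 0" by (auto simp: common_eigenfunction_def)
  have "0 < Coset.order G" using fin by (simp add: order_gt_0_iff_finite)
  moreover have "H (c [^] (0::nat) \<otimes> b) i \<noteq> 0" using bi by simp
  ultimately obtain \<mu> where \<mu>: "\<mu> ^ Coset.order G = 1" "eigenprojection c \<mu> H b i \<noteq> 0"
    unfolding eigenprojection_def
    using ex_root_of_unity_poly_nonzero[of 0 "Coset.order G" "\<lambda>k. H (c [^] k \<otimes> b) i"]
    by blast
  have "\<exists>\<kappa>. \<forall>b\<in>carrier G. \<forall>i. eigenprojection c \<mu> H (a \<otimes> b) i = \<kappa> * eigenprojection c \<mu> H b i"
    if a: "a \<in> insert c S" for a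
  proof (cases "a = c")
    case True
    then show ?thesis
      by (intro exI[of _ "inverse \<mu>"]) (simp add: eigenprojection_translate[OF fin c _ \<mu>(1)])
  next
    case False
    then have "a \<in> S" using a by simp
    then obtain \<kappa> where "\<forall>b\<in>carrier G. \<forall>i. H (a \<otimes> b) i = \<kappa> * H b i"
      using H(2) unfolding common_eigenfunction_def by meson
    then show ?thesis
      using False a S by (intro exI[of _ \<kappa>] ballI allI eigenprojection_commute[OF c]) auto
  qed
  then have "common_eigenfunction (insert c S) (eigenprojection c \<mu> H)"
    using bi(1) \<mu>(2) by (auto simp: common_eigenfunction_def)
  then show ?case using eigenprojection_in_invariant[OF V H(1) c] by (rule bexI)
qed

lemma (in comm_group) translation_invariant_character:
  assumes fin: "finite (carrier G)" and V: "translation_invariant V"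
    and F: "F \<in> V" "b \<in> carrier G" "F b i \<noteq> 0"
  obtains H \<chi> j where "H \<in> V" "\<chi> \<in> characters G" "H \<one> j \<noteq> 0"
    "\<forall>a\<in>carrier G. \<forall>i. H a i = \<chi> a * H \<one> i"
proof -
  obtain H where H: "H \<in> V" "common_eigenfunction (carrier G) H"
    using common_eigenfunction_exists[OF fin V F fin subset_refl] by (rule bexE)
  then obtain b j where b: "b \<in> carrier G" "H b j \<noteq> 0"
    and "\<forall>a\<in>carrier G. \<exists>\<kappa>. \<forall>b\<in>carrier G. \<forall>i. H (a \<otimes> b) i = \<kappa> * H b i"
    by (auto simp: common_eigenfunction_def)
  from bchoice[OF this(3)] obtain \<chi>
    where \<chi>: "\<And>a b i. a \<in> carrier G \<Longrightarrow> b \<in> carrier G \<Longrightarrow> H (a \<otimes> b) i = \<chi> a * H b i"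
    by blast
  have eval: "H a i = \<chi> a * H \<one> i" if "a \<in> carrier G" for a i
    using \<chi>[OF that one_closed] that by simp
  have nonzero: "H \<one> j \<noteq> 0" using eval[OF b(1), of j] b(2) by auto
  have "\<chi> \<one> = 1" using eval[OF one_closed, of j] nonzero by simp
  moreover have "\<chi> (a \<otimes> b) = \<chi> a * \<chi> b" if "a \<in> carrier G" "b \<in> carrier G" for a b
    using \<chi>[OF that, of j] eval[of "a \<otimes> b" j] eval[of b j] that nonzero by simp
  ultimately have "restrict \<chi> (carrier G) \<in> characters G"
    by (simp add: characters_iff)
  then show thesis
  proof (rule that[OF H(1) _ nonzero])
    show "\<forall>a\<in>carrier G. \<forall>i. H a i = restrict \<chi> (carrier G) a * H \<one> i"
      using eval by (metis restrict_apply')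
  qed
qed

text \<open>On the functions whose sum over each orbit of \<open>a\<close> vanishes, \<open>a\<close> has no nonzero fixed
  vector.\<close>

lemma (in comm_group) separating_character:
  assumes fin: "finite (carrier G)" and a: "a \<in> carrier G" "a \<noteq> \<one>"
  shows "\<exists>\<chi>\<in>characters G. \<chi> a \<noteq> 1"
proof -
  define V :: "('a \<Rightarrow> unit \<Rightarrow> complex) set"
    where "V = {F. \<forall>b\<in>carrier G. \<forall>i. (\<Sum>k<Coset.order G. F (a [^] k \<otimes> b) i) = 0}"
  define \<delta> :: "'a \<Rightarrow> complex" where "\<delta> b = of_bool (b = \<one>)" for b
  have V: "translation_invariant V"
    using a(1) unfolding translation_invariant_def V_def
    by (auto simp: sum.distrib sum_distrib_left[symmetric] m_lcomm[of _ "a [^] _"])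
  have telescope: "(\<Sum>k<n. \<delta> (a [^] k \<otimes> b) - \<delta> (a \<otimes> (a [^] k \<otimes> b))) = \<delta> b - \<delta> (a [^] n \<otimes> b)"
    if b: "b \<in> carrier G" for b and n :: nat
  proof -
    have "a \<otimes> (a [^] k \<otimes> b) = a [^] Suc k \<otimes> b" for k :: nat
      using a(1) b nat_pow_Suc2[of a k] by (simp add: m_assoc del: nat_pow_Suc)
    then show ?thesis
      using b sum_lessThan_telescope'[of "\<lambda>k. \<delta> (a [^] k \<otimes> b)" n] by (simp del: nat_pow_Suc)
  qed
  have difference: "(\<lambda>b _. \<delta> b - \<delta> (a \<otimes> b)) \<in> V"
    using a(1) telescope[of _ "Coset.order G"] by (simp add: V_def pow_order_eq_1)
  have difference_nonzero: "\<delta> \<one> - \<delta> (a \<otimes> \<one>) \<noteq> 0" using a by (simp add: \<delta>_def)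
  obtain H \<chi> j where H: "H \<in> V" and \<chi>: "\<chi> \<in> characters G" and nonzero: "H \<one> j \<noteq> 0"
    and eval: "\<forall>b\<in>carrier G. \<forall>i. H b i = \<chi> b * H \<one> i"
    by (rule translation_invariant_character[OF fin V difference one_closed difference_nonzero])
  have "H (a [^] k \<otimes> \<one>) j = \<chi> a ^ k * H \<one> j" for k :: nat
    using a(1) bspec[OF eval, of "a [^] k"] by (simp add: character_pow[OF \<chi>])
  then have "(\<Sum>k<Coset.order G. \<chi> a ^ k) * H \<one> j = (\<Sum>k<Coset.order G. H (a [^] k \<otimes> \<one>) j)"
    by (simp add: sum_distrib_right)
  also have "\<dots> = 0" using H unfolding V_def by blast
  finally have "(\<Sum>k<Coset.order G. \<chi> a ^ k) = 0" using nonzero by simp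
  then have "\<chi> a \<noteq> 1" using fin by (auto simp: order_gt_0_iff_finite[symmetric])
  then show ?thesis using \<chi> by blast
qed

subsection \<open>The dual group\<close>

definition dual_group :: "('g, 'm) monoid_scheme \<Rightarrow> ('g \<Rightarrow> complex) monoid" where
  "dual_group G = \<lparr>carrier = characters G, mult = (\<lambda>\<chi> \<psi>. \<lambda>a\<in>carrier G. \<chi> a * \<psi> a),
     one = (\<lambda>a\<in>carrier G. 1)\<rparr>"

lemma (in group) group_dual_group: "group (dual_group G)"
proof (rule groupI)
  fix \<chi> assume "\<chi> \<in> carrier (dual_group G)"
  then have \<chi>: "\<chi> \<in> characters G" by (simp add: dual_group_def)
  have "(\<lambda>a\<in>carrier G. inverse (\<chi> a)) \<in> characters G"
    by (simp add: characters_iff character_one[OF \<chi>] character_mult[OF \<chi>])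
  moreover have "(\<lambda>a\<in>carrier G. (\<lambda>a\<in>carrier G. inverse (\<chi> a)) a * \<chi> a) = (\<lambda>a\<in>carrier G. 1)"
    by (intro restrict_ext) (simp add: character_nonzero[OF \<chi>])
  ultimately show "\<exists>\<psi>\<in>carrier (dual_group G). \<psi> \<otimes>\<^bsub>dual_group G\<^esub> \<chi> = \<one>\<^bsub>dual_group G\<^esub>"
    by (intro bexI[of _ "\<lambda>a\<in>carrier G. inverse (\<chi> a)"]) (simp_all add: dual_group_def)
  show "\<one>\<^bsub>dual_group G\<^esub> \<otimes>\<^bsub>dual_group G\<^esub> \<chi> = \<chi>"
    using \<chi> by (intro extensionalityI) (auto simp: dual_group_def characters_def)
qed (auto simp: dual_group_def characters_iff mult.assoc)

lemma (in group) evaluation_character: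
  assumes "a \<in> carrier G"
  shows "(\<lambda>\<chi>\<in>characters G. \<chi> a) \<in> characters (dual_group G)"
proof -
  interpret dual: group "dual_group G" by (rule group_dual_group)
  show ?thesis
    using assms dual.m_closed dual.one_closed unfolding dual.characters_iff
    by (simp add: dual_group_def)
qed

lemma (in comm_group) card_characters:
  assumes fin: "finite (carrier G)"
  shows "card (characters G) = Coset.order G"
proof -
  interpret dual: group "dual_group G" by (rule group_dual_group)
  have carrier_dual: "carrier (dual_group G) = characters G" by (simp add: dual_group_def)
  have dual_sum: "(\<Sum>\<chi>\<in>characters G. \<chi> a) = (if a = \<one> then of_nat (card (characters G)) else 0)"
    if a: "a \<in> carrier G" for a
  proof (cases "a = \<one>")
    case True
    then show ?thesis by (simp add: character_one)
  next
    case False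
    then have "(\<lambda>\<chi>\<in>characters G. \<chi> a) \<noteq> (\<lambda>\<chi>\<in>characters G. 1)"
      using separating_character[OF fin a] by (metis restrict_apply')
    then show ?thesis
      using dual.sum_nontrivial_character[OF evaluation_character[OF a]] False
      by (simp add: carrier_dual)
  qed
  have "of_nat (card (characters G)) = (\<Sum>a\<in>carrier G. \<Sum>\<chi>\<in>characters G. \<chi> a)"
    using fin by (simp add: dual_sum)
  also have "\<dots> = (\<Sum>\<chi>\<in>characters G. \<Sum>a\<in>carrier G. \<chi> a)" by (rule sum.swap)
  also have "\<dots> = (\<Sum>\<chi>\<in>characters G. if \<chi> = \<one>\<^bsub>dual_group G\<^esub> then of_nat (Coset.order G) else 0)"
    by (intro sum.cong) (auto simp: sum_nontrivial_character dual_group_def Coset.order_def)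
  also have "\<dots> = (of_nat (Coset.order G) :: complex)"
    using finite_characters[OF fin] dual.one_closed by (simp add: carrier_dual)
  finally show ?thesis by simp
qed

section \<open>Complex matrix representations\<close>

lemma carrier_GLC: "carrier (GLC n) = {P \<in> carrier_mat n n. det P \<noteq> 0}"
proof (intro equalityI subsetI)
  fix P assume "P \<in> carrier (GLC n)"
  then have P: "P \<in> Units (ring_mat TYPE(complex) n ())" by (simp add: GLC_def units_of_carrier)
  then have "P \<in> carrier_mat n n" by (simp add: Units_def ring_mat_simps)
  then show "P \<in> {P \<in> carrier_mat n n. det P \<noteq> 0}" using unit_imp_det_non_zero[OF P] by simp
next
  fix P :: "complex mat" assume "P \<in> {P \<in> carrier_mat n n. det P \<noteq> 0}"
  then show "P \<in> carrier (GLC n)"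
    using det_non_zero_imp_unit[of P n "()"] by (simp add: GLC_def units_of_carrier)
qed

lemma mult_GLC [simp]: "mult (GLC n) = (*)"
  and one_GLC [simp]: "one (GLC n) = 1\<^sub>m n"
  by (simp_all add: GLC_def units_of_mult units_of_one ring_mat_simps)

lemma group_GLC: "group (GLC n)"
proof -
  interpret ring "ring_mat TYPE(complex) n ()" by (rule ring_mat)
  show ?thesis unfolding GLC_def by (rule units_group)
qed

lemma is_rep_carrier: "is_rep G n \<rho> \<Longrightarrow> g \<in> carrier G \<Longrightarrow> \<rho> g \<in> carrier_mat n n"
  by (auto simp: is_rep_def hom_def carrier_GLC)

lemma is_rep_mult:
  "is_rep G n \<rho> \<Longrightarrow> g \<in> carrier G \<Longrightarrow> h \<in> carrier G \<Longrightarrow> \<rho> (g \<otimes>\<^bsub>G\<^esub> h) = \<rho> g * \<rho> h"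
  by (simp add: is_rep_def hom_def)

lemma is_rep_compose_hom:
  "is_rep G n \<rho> \<Longrightarrow> h \<in> hom H G \<Longrightarrow> is_rep H n (\<lambda>a. \<rho> (h a))"
  by (auto simp: is_rep_def hom_def)

lemma is_irrep_imp_is_rep: "is_irrep G n \<rho> \<Longrightarrow> is_rep G n \<rho>"
  by (simp add: is_irrep_def)

lemma (in group) is_rep_one: "is_rep G n \<rho> \<Longrightarrow> \<rho> \<one> = 1\<^sub>m n"
  using hom_one[of \<rho> G "GLC n"] group_GLC is_group by (simp add: is_rep_def)

lemma (in group) is_repI:
  assumes carrier: "\<And>g. g \<in> carrier G \<Longrightarrow> \<rho> g \<in> carrier_mat n n"
    and one: "\<rho> \<one> = 1\<^sub>m n"
    and mult: "\<And>g h. g \<in> carrier G \<Longrightarrow> h \<in> carrier G \<Longrightarrow> \<rho> (g \<otimes> h) = \<rho> g * \<rho> h"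
  shows "is_rep G n \<rho>"
proof -
  have "det (\<rho> g) \<noteq> 0" if g: "g \<in> carrier G" for g
  proof -
    have "\<rho> g * \<rho> (inv g) = 1\<^sub>m n" using mult[OF g inv_closed[OF g]] g by (simp add: one)
    then have "det (\<rho> g) * det (\<rho> (inv g)) = 1"
      using det_mult[OF carrier[OF g] carrier[OF inv_closed[OF g]]] by simp
    then show ?thesis by auto
  qed
  then show ?thesis using carrier mult by (auto simp: is_rep_def hom_def carrier_GLC)
qed

lemma (in group) is_rep_dim_unique: "is_rep G n \<rho> \<Longrightarrow> is_rep G m \<rho> \<Longrightarrow> n = m"
  using is_rep_carrier[of G n \<rho> \<one>] is_rep_carrier[of G m \<rho> \<one>] by auto

lemma (in group) equiv_repD:
  assumes "equiv_rep G \<rho> \<sigma>" "is_rep G n \<rho>"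
  obtains P where "is_rep G n \<sigma>" "P \<in> carrier_mat n n" "det P \<noteq> 0"
    "\<forall>g\<in>carrier G. P * \<rho> g = \<sigma> g * P"
proof -
  from assms(1) obtain m P where "is_rep G m \<rho>" "is_rep G m \<sigma>" "P \<in> carrier (GLC m)"
    "\<forall>g\<in>carrier G. P * \<rho> g = \<sigma> g * P" unfolding equiv_rep_def by blast
  moreover from this have "m = n" using is_rep_dim_unique assms(2) by blast
  ultimately show thesis using that by (auto simp: carrier_GLC)
qed

lemma equiv_rep_sym:
  assumes "equiv_rep G \<rho> \<sigma>"
  shows "equiv_rep G \<sigma> \<rho>"
proof -
  from assms obtain n P where rep: "is_rep G n \<rho>" "is_rep G n \<sigma>" and P: "P \<in> carrier (GLC n)"
    and comm: "\<And>g. g \<in> carrier G \<Longrightarrow> P * \<rho> g = \<sigma> g * P" unfolding equiv_rep_def by blast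
  interpret GL: group "GLC n" by (rule group_GLC)
  let ?inv = "inv\<^bsub>GLC n\<^esub> P"
  have "?inv * \<sigma> g = \<rho> g * ?inv" if g: "g \<in> carrier G" for g
  proof -
    have closed: "\<rho> g \<in> carrier (GLC n)" "\<sigma> g \<in> carrier (GLC n)"
      using rep g by (auto simp: is_rep_def hom_def)
    have "P \<otimes>\<^bsub>GLC n\<^esub> \<rho> g = \<sigma> g \<otimes>\<^bsub>GLC n\<^esub> P" using comm[OF g] by simp
    then have "\<rho> g = ?inv \<otimes>\<^bsub>GLC n\<^esub> (\<sigma> g \<otimes>\<^bsub>GLC n\<^esub> P)"
      using GL.inv_solve_left[of "\<rho> g" P "\<sigma> g \<otimes>\<^bsub>GLC n\<^esub> P"] P closed by (simp del: mult_GLC)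
    then have "\<rho> g \<otimes>\<^bsub>GLC n\<^esub> ?inv = ?inv \<otimes>\<^bsub>GLC n\<^esub> \<sigma> g"
      using P closed by (simp add: GL.m_assoc del: mult_GLC one_GLC)
    then show ?thesis by simp
  qed
  then show ?thesis
    unfolding equiv_rep_def using rep GL.inv_closed[OF P] by blast
qed

subsection \<open>Invariant subspaces and Schur's lemma\<close>

abbreviation vec_subspace :: "nat \<Rightarrow> complex vec set \<Rightarrow> bool" where
  "vec_subspace n W \<equiv> VectorSpace.subspace class_ring W (module_vec TYPE(complex) n)"

definition invariant_subspace ::
  "('g, 'm) monoid_scheme \<Rightarrow> nat \<Rightarrow> ('g \<Rightarrow> complex mat) \<Rightarrow> complex vec set \<Rightarrow> bool" where
  "invariant_subspace G n \<rho> W \<longleftrightarrow>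
     vec_subspace n W \<and>
     (\<forall>g\<in>carrier G. \<forall>w\<in>W. \<rho> g *\<^sub>v w \<in> W)"

lemma is_irrepI:
  assumes "is_rep G n \<rho>" "n > 0"
    and "\<And>W w. invariant_subspace G n \<rho> W \<Longrightarrow> w \<in> W \<Longrightarrow> w \<in> carrier_vec n \<Longrightarrow> w \<noteq> 0\<^sub>v n
      \<Longrightarrow> W = carrier_vec n"
  shows "is_irrep G n \<rho>"
  using assms unfolding is_irrep_def invariant_subspace_def VectorSpace.subspace_def submodule_def
  by (auto simp: module_vec_simps)

lemma is_irrep_invariant_subspace:
  assumes "is_irrep G n \<rho>" "invariant_subspace G n \<rho> W" "w \<in> W" "w \<noteq> 0\<^sub>v n"
  shows "W = carrier_vec n"
  using assms unfolding is_irrep_def invariant_subspace_def by blast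

lemma subspace_add_closed:
  "vec_subspace n W \<Longrightarrow> v \<in> W \<Longrightarrow> w \<in> W \<Longrightarrow> v + w \<in> W"
  and subspace_smult_closed:
  "vec_subspace n W \<Longrightarrow> v \<in> W \<Longrightarrow> c \<cdot>\<^sub>v v \<in> W"
  and subspace_carrier_vec:
  "vec_subspace n W \<Longrightarrow> W \<subseteq> carrier_vec n"
  by (auto simp: VectorSpace.subspace_def submodule_def module_vec_simps)

lemma subspace_eq_carrier_vec:
  assumes W: "vec_subspace n W"
    and unit: "\<And>i. i < n \<Longrightarrow> unit_vec n i \<in> W"
  shows "W = carrier_vec n"
proof
  interpret vec_space "TYPE(complex)" n .
  have "span (set (unit_vecs n)) \<subseteq> W"
    using W unit by (intro span_is_subset) (auto simp: unit_vecs_def VectorSpace.subspace_def)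
  then show "carrier_vec n \<subseteq> W" by (simp add: span_unit_vecs_is_carrier)
qed (rule subspace_carrier_vec[OF W])

lemma linear_map_mult_mat_vec:
  fixes Q :: "'a :: field mat"
  assumes "Q \<in> carrier_mat m n"
  shows "linear_map class_ring (module_vec TYPE('a) n) (module_vec TYPE('a) m)
    (\<lambda>v. Q *\<^sub>v v)"
proof -
  interpret V: vec_space "TYPE('a)" n .
  interpret W: vec_space "TYPE('a)" m .
  show ?thesis
    using assms
    by unfold_locales
      (auto simp: module_hom_def module_vec_simps mult_add_distrib_mat_vec mult_mat_vec)
qed

lemma mult_mat_zero_vec:
  fixes M :: "'a :: semiring_0 mat"
  shows "M \<in> carrier_mat r c \<Longrightarrow> M *\<^sub>v 0\<^sub>v c = 0\<^sub>v r"
  by (intro eq_vecI) auto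

lemma smult_vec_eq_zero_iff:
  fixes v :: "'a :: semiring_no_zero_divisors vec"
  assumes "v \<in> carrier_vec n"
  shows "c \<cdot>\<^sub>v v = 0\<^sub>v n \<longleftrightarrow> c = 0 \<or> v = 0\<^sub>v n"
  using assms by (auto simp: vec_eq_iff)

lemma add_smult_vec_eq_zeroD:
  fixes u v :: "'a :: comm_ring_1 vec"
  assumes carrier: "u \<in> carrier_vec n" "v \<in> carrier_vec n" and zero: "u + c \<cdot>\<^sub>v v = 0\<^sub>v n"
  shows "u = (- c) \<cdot>\<^sub>v v"
proof (rule eq_vecI)
  fix i assume "i < dim_vec ((- c) \<cdot>\<^sub>v v)"
  then have "u $ i + c * v $ i = 0"
    using arg_cong[OF zero, of "\<lambda>w. w $ i"] carrier by simp
  then show "u $ i = ((- c) \<cdot>\<^sub>v v) $ i"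
    using carrier \<open>i < dim_vec ((- c) \<cdot>\<^sub>v v)\<close> by (simp add: add_eq_0_iff2)
qed (use carrier in simp)

lemma mult_mat_unit_vec:
  fixes M :: "'a :: semiring_1 mat"
  assumes "M \<in> carrier_mat r c" "j < c"
  shows "M *\<^sub>v unit_vec c j = col M j"
  using assms by (intro eq_vecI) (auto simp: scalar_prod_right_unit)

lemma mat_nonzero_ex_col:
  fixes Q :: "'a :: zero mat"
  assumes "Q \<in> carrier_mat m n" "Q \<noteq> 0\<^sub>m m n"
  shows "\<exists>j<n. col Q j \<noteq> 0\<^sub>v m"
proof (rule ccontr)
  assume "\<not> ?thesis"
  then have "Q $$ (i, j) = 0" if "i < m" "j < n" for i j
    using that assms(1) index_col[of i Q j] by (metis carrier_matD index_zero_vec(1))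
  then show False using assms by (auto intro: eq_matI)
qed

definition intertwiner ::
  "('g, 'm) monoid_scheme \<Rightarrow> nat \<Rightarrow> ('g \<Rightarrow> complex mat) \<Rightarrow> nat \<Rightarrow> ('g \<Rightarrow> complex mat)
     \<Rightarrow> complex mat \<Rightarrow> bool" where
  "intertwiner G n \<rho> m \<sigma> Q \<longleftrightarrow> Q \<in> carrier_mat m n \<and> (\<forall>g\<in>carrier G. Q * \<rho> g = \<sigma> g * Q)"

lemma intertwiner_mult_vec:
  assumes Q: "intertwiner G n \<rho> m \<sigma> Q" and rep: "is_rep G n \<rho>" "is_rep G m \<sigma>"
    and "g \<in> carrier G" "v \<in> carrier_vec n"
  shows "Q *\<^sub>v (\<rho> g *\<^sub>v v) = \<sigma> g *\<^sub>v (Q *\<^sub>v v)"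
  using assms is_rep_carrier[OF rep(1), of g] is_rep_carrier[OF rep(2), of g]
    assoc_mult_mat_vec[of Q m n "\<rho> g" n v] assoc_mult_mat_vec[of "\<sigma> g" m m Q n v]
  by (simp add: intertwiner_def)

lemma intertwiner_kernel_invariant:
  assumes Q: "intertwiner G n \<rho> m \<sigma> Q" and rep: "is_rep G n \<rho>" "is_rep G m \<sigma>"
  shows "invariant_subspace G n \<rho> {v \<in> carrier_vec n. Q *\<^sub>v v = 0\<^sub>v m}"
proof -
  interpret Q: linear_map class_ring "module_vec TYPE(complex) n" "module_vec TYPE(complex) m"
    "\<lambda>v. Q *\<^sub>v v"
    using Q by (intro linear_map_mult_mat_vec) (simp add: intertwiner_def)
  show ?thesis
    using Q.kerT_is_subspace mult_mat_vec_carrier[OF is_rep_carrier[OF rep(1)]]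
      mult_mat_zero_vec[OF is_rep_carrier[OF rep(2)]]
    by (auto simp: invariant_subspace_def Q.ker_def module_vec_simps intertwiner_mult_vec[OF Q rep])
qed

lemma intertwiner_image_invariant:
  assumes Q: "intertwiner G n \<rho> m \<sigma> Q" and rep: "is_rep G n \<rho>" "is_rep G m \<sigma>"
  shows "invariant_subspace G m \<sigma> ((\<lambda>v. Q *\<^sub>v v) ` carrier_vec n)"
proof -
  interpret Q: linear_map class_ring "module_vec TYPE(complex) n" "module_vec TYPE(complex) m"
    "\<lambda>v. Q *\<^sub>v v"
    using Q by (intro linear_map_mult_mat_vec) (simp add: intertwiner_def)
  have "\<sigma> g *\<^sub>v (Q *\<^sub>v v) \<in> (\<lambda>v. Q *\<^sub>v v) ` carrier_vec n"
    if "g \<in> carrier G" "v \<in> carrier_vec n" for g v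
    using mult_mat_vec_carrier[OF is_rep_carrier[OF rep(1) that(1)] that(2)]
    by (auto simp: intertwiner_mult_vec[OF Q rep that, symmetric])
  then show ?thesis
    using Q.imT_is_subspace by (auto simp: invariant_subspace_def Q.im_def module_vec_simps)
qed

lemma bijective_mat_square_det_nonzero:
  fixes Q :: "'a :: field mat"
  assumes Q: "Q \<in> carrier_mat m n"
    and kernel: "{v \<in> carrier_vec n. Q *\<^sub>v v = 0\<^sub>v m} = {0\<^sub>v n}"
    and image: "(\<lambda>v. Q *\<^sub>v v) ` carrier_vec n = carrier_vec m"
  shows "m = n" and "det Q \<noteq> 0"
proof -
  interpret V: vec_space "TYPE('a)" n .
  interpret W: vec_space "TYPE('a)" m .
  interpret Q: linear_map class_ring "module_vec TYPE('a) n" "module_vec TYPE('a) m"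
    "\<lambda>v. Q *\<^sub>v v"
    by (rule linear_map_mult_mat_vec[OF Q])
  have "inj_on (\<lambda>v. Q *\<^sub>v v) (carrier (module_vec TYPE('a) n))"
    using kernel by (intro Q.Ke0_imp_inj) (simp add: Q.ker_def module_vec_simps)
  then have "V.dim = W.dim"
    using image by (intro Q.dim_eq) (simp_all add: module_vec_simps)
  then show dim: "m = n" by (simp add: V.dim_is_n W.dim_is_n)
  show "det Q \<noteq> 0"
    using det_0_iff_vec_prod_zero_field[of Q n] Q kernel dim by blast
qed

theorem (in group) schur_lemma:
  assumes \<rho>: "is_irrep G n \<rho>" and \<sigma>: "is_irrep G m \<sigma>"
    and Q: "intertwiner G n \<rho> m \<sigma> Q" "Q \<noteq> 0\<^sub>m m n"
  shows "equiv_rep G \<rho> \<sigma>"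
proof -
  note rep = is_irrep_imp_is_rep[OF \<rho>] is_irrep_imp_is_rep[OF \<sigma>]
  let ?ker = "{v \<in> carrier_vec n. Q *\<^sub>v v = 0\<^sub>v m}"
  let ?im = "(\<lambda>v. Q *\<^sub>v v) ` carrier_vec n"
  have Q_carrier: "Q \<in> carrier_mat m n" using Q(1) by (simp add: intertwiner_def)
  obtain j where j: "j < n" "Q *\<^sub>v unit_vec n j \<noteq> 0\<^sub>v m"
    using mat_nonzero_ex_col[OF Q_carrier Q(2)] mult_mat_unit_vec[OF Q_carrier] by metis
  have "unit_vec n j \<notin> ?ker" using j(2) by simp
  then have "?ker \<noteq> carrier_vec n" using unit_vec_carrier by blast
  then have "w = 0\<^sub>v n" if "w \<in> ?ker" for w
    using is_irrep_invariant_subspace[OF \<rho> intertwiner_kernel_invariant[OF Q(1) rep] that] by blast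
  moreover have "0\<^sub>v n \<in> ?ker" using Q_carrier by auto
  ultimately have kernel: "?ker = {0\<^sub>v n}" by blast
  have image: "?im = carrier_vec m"
    by (rule is_irrep_invariant_subspace[OF \<sigma> intertwiner_image_invariant[OF Q(1) rep] _ j(2)]) simp
  note square = bijective_mat_square_det_nonzero[OF Q_carrier kernel image]
  then have "Q \<in> carrier (GLC n)" using Q_carrier by (simp add: carrier_GLC)
  then show ?thesis
    using rep Q(1) square(1) unfolding equiv_rep_def intertwiner_def by blast
qed

subsection \<open>One-dimensional representations\<close>

lemma mat1_carrier [simp]: "mat1 c \<in> carrier_mat 1 1"
  and mat1_one: "mat1 1 = 1\<^sub>m 1"
  and entry1_mat1 [simp]: "entry1 (mat1 c) = c"
  by (auto simp: mat1_def entry1_def mat_of_rows_list_def)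

lemmas mat1_carrier_Suc [simp] = mat1_carrier[unfolded One_nat_def]

lemma mat1_entry1: "M \<in> carrier_mat 1 1 \<Longrightarrow> mat1 (entry1 M) = M"
  by (intro eq_matI) (auto simp: mat1_def entry1_def mat_of_rows_list_def)

lemma entry1_mult:
  "M \<in> carrier_mat 1 1 \<Longrightarrow> N \<in> carrier_mat 1 1 \<Longrightarrow> entry1 (M * N) = entry1 M * entry1 N"
  by (simp add: entry1_def scalar_prod_def)

lemma mat1_mult: "mat1 c * mat1 d = mat1 (c * d)"
  using mat1_entry1[OF mult_carrier_mat[OF mat1_carrier mat1_carrier], of c d]
    entry1_mult[OF mat1_carrier mat1_carrier, of c d] by simp

definition character_of :: "('g, 'm) monoid_scheme \<Rightarrow> ('g \<Rightarrow> complex mat) \<Rightarrow> 'g \<Rightarrow> complex" where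
  "character_of G \<rho> = (\<lambda>g\<in>carrier G. entry1 (\<rho> g))"

lemma character_of_apply: "g \<in> carrier G \<Longrightarrow> character_of G \<rho> g = entry1 (\<rho> g)"
  by (simp add: character_of_def)

lemma is_rep_1_eq_mat1:
  "is_rep G 1 \<rho> \<Longrightarrow> g \<in> carrier G \<Longrightarrow> \<rho> g = mat1 (character_of G \<rho> g)"
  by (simp add: character_of_def mat1_entry1 is_rep_carrier)

context group
begin

lemma character_of_in_characters: "is_rep G 1 \<rho> \<Longrightarrow> character_of G \<rho> \<in> characters G"
  using is_rep_one[of 1 \<rho>] entry1_mat1[of 1]
  by (auto simp: characters_iff character_of_def is_rep_mult entry1_mult is_rep_carrier mat1_one
      simp del: entry1_mat1)

lemma is_rep_mat1: "\<chi> \<in> characters G \<Longrightarrow> is_rep G 1 (\<lambda>g. mat1 (\<chi> g))"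
  by (intro is_repI) (simp_all add: character_one character_mult mat1_mult mat1_one)

lemma character_of_mat1: "\<chi> \<in> characters G \<Longrightarrow> character_of G (\<lambda>g. mat1 (\<chi> g)) = \<chi>"
  by (simp add: character_of_def characters_def extensional_restrict)

lemma is_rep_1_irrep:
  assumes "is_rep G 1 \<rho>"
  shows "is_irrep G 1 \<rho>"
proof (rule is_irrepI[OF assms])
  fix W w assume W: "invariant_subspace G 1 \<rho> W"
    and w: "w \<in> W" "w \<in> carrier_vec 1" "w \<noteq> 0\<^sub>v 1"
  then have subspace: "vec_subspace 1 W"
    by (simp add: invariant_subspace_def)
  have "w $ 0 \<noteq> 0" using w(2,3) by (auto intro: eq_vecI)
  then have "unit_vec 1 0 = inverse (w $ 0) \<cdot>\<^sub>v w"
    using w(2) by (intro eq_vecI) auto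
  then have "unit_vec 1 0 \<in> W" using subspace_smult_closed[OF subspace w(1)] by simp
  then show "W = carrier_vec 1" by (intro subspace_eq_carrier_vec[OF subspace]) simp
qed simp

lemma equiv_rep_1_iff:
  assumes \<rho>: "is_rep G 1 \<rho>"
  shows "equiv_rep G \<rho> \<sigma> \<longleftrightarrow> is_rep G 1 \<sigma> \<and> character_of G \<sigma> = character_of G \<rho>"
proof
  assume "equiv_rep G \<rho> \<sigma>"
  then obtain P where \<sigma>: "is_rep G 1 \<sigma>" and P: "P \<in> carrier_mat 1 1" "det P \<noteq> 0"
    and comm: "\<forall>g\<in>carrier G. P * \<rho> g = \<sigma> g * P" by (rule equiv_repD[OF _ \<rho>])
  have "entry1 P \<noteq> 0" using P det_single[OF P(1)] by (simp add: entry1_def)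
  moreover have "entry1 P * entry1 (\<rho> g) = entry1 (\<sigma> g) * entry1 P" if "g \<in> carrier G" for g
    using bspec[OF comm that] entry1_mult P(1) is_rep_carrier[OF \<rho> that]
      is_rep_carrier[OF \<sigma> that] by metis
  ultimately show "is_rep G 1 \<sigma> \<and> character_of G \<sigma> = character_of G \<rho>"
    using \<sigma> by (auto simp: character_of_def)
next
  assume \<sigma>: "is_rep G 1 \<sigma> \<and> character_of G \<sigma> = character_of G \<rho>"
  then have "\<sigma> g = \<rho> g" if "g \<in> carrier G" for g
    using is_rep_1_eq_mat1[OF \<rho> that] is_rep_1_eq_mat1[of G \<sigma> g] that by simp
  then have "1\<^sub>m 1 * \<rho> g = \<sigma> g * 1\<^sub>m 1" if "g \<in> carrier G" for g
    using is_rep_carrier[OF \<rho> that] that by simp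
  moreover have "1\<^sub>m 1 \<in> carrier (GLC 1)" by (simp add: carrier_GLC)
  ultimately show "equiv_rep G \<rho> \<sigma>"
    unfolding equiv_rep_def using \<rho> \<sigma> by blast
qed

lemma enumerates_one_dimensional_reps_iff:
  assumes X: "X \<subseteq> characters G"
  shows "enumerates_reps G {\<rho>. is_rep G 1 \<rho> \<and> character_of G \<rho> \<in> X} N \<rho> \<longleftrightarrow>
    (\<forall>j\<in>{1..N}. is_rep G 1 (\<rho> j)) \<and> bij_betw (\<lambda>j. character_of G (\<rho> j)) {1..N} X"
    (is "enumerates_reps G ?C N \<rho> \<longleftrightarrow> _ \<and> bij_betw ?c {1..N} X")
proof (cases "\<forall>j\<in>{1..N}. is_rep G 1 (\<rho> j)")
  case False
  then show ?thesis by (auto simp: enumerates_reps_def)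
next
  case rep: True
  have inj: "(\<forall>i\<in>{1..N}. \<forall>j\<in>{1..N}. i \<noteq> j \<longrightarrow> \<not> equiv_rep G (\<rho> i) (\<rho> j)) \<longleftrightarrow> inj_on ?c {1..N}"
    using rep unfolding inj_on_def by (metis equiv_rep_1_iff)
  have surj: "(\<forall>\<sigma>\<in>?C. \<exists>j\<in>{1..N}. equiv_rep G \<sigma> (\<rho> j)) \<longleftrightarrow> X \<subseteq> ?c ` {1..N}"
  proof
    assume complete: "\<forall>\<sigma>\<in>?C. \<exists>j\<in>{1..N}. equiv_rep G \<sigma> (\<rho> j)"
    show "X \<subseteq> ?c ` {1..N}"
    proof
      fix \<chi> assume "\<chi> \<in> X"
      then have \<chi>: "\<chi> \<in> characters G" and "(\<lambda>g. mat1 (\<chi> g)) \<in> ?C"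
        using X by (auto simp: is_rep_mat1 character_of_mat1 simp del: One_nat_def)
      then obtain j where j: "j \<in> {1..N}" and "equiv_rep G (\<lambda>g. mat1 (\<chi> g)) (\<rho> j)"
        using complete by blast
      then have "\<chi> = ?c j"
        by (simp add: equiv_rep_1_iff[OF is_rep_mat1[OF \<chi>]] character_of_mat1[OF \<chi>])
      then show "\<chi> \<in> ?c ` {1..N}" using j by blast
    qed
  next
    assume "X \<subseteq> ?c ` {1..N}"
    show "\<forall>\<sigma>\<in>?C. \<exists>j\<in>{1..N}. equiv_rep G \<sigma> (\<rho> j)"
    proof
      fix \<sigma> assume "\<sigma> \<in> ?C"
      then have \<sigma>: "is_rep G 1 \<sigma>" and "character_of G \<sigma> \<in> X" by auto
      then obtain j where "j \<in> {1..N}" "character_of G \<sigma> = ?c j"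
        using \<open>X \<subseteq> ?c ` {1..N}\<close> by blast
      then show "\<exists>j\<in>{1..N}. equiv_rep G \<sigma> (\<rho> j)"
        using rep equiv_rep_1_iff[OF \<sigma>] by metis
    qed
  qed
  show ?thesis
    unfolding enumerates_reps_def inj surj bij_betw_def using rep by auto
qed

end

lemma mult_mat_of_cols:
  fixes M :: "'a :: semiring_0 mat"
  assumes "M \<in> carrier_mat r n" "set vs \<subseteq> carrier_vec n"
  shows "M * mat_of_cols n vs = mat_of_cols r (map ((*\<^sub>v) M) vs)"
  using assms by (intro eq_matI) (auto simp: mat_of_cols_index subset_iff)

lemma mat_of_cols_single_mult_mat1:
  assumes "v \<in> carrier_vec n"
  shows "mat_of_cols n [v] * mat1 c = mat_of_cols n [c \<cdot>\<^sub>v v]"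
  using assms by (intro eq_matI)
    (auto simp: mat_of_cols_def mat1_def mat_of_rows_list_def scalar_prod_def)

lemma mult_eigenvector_column:
  fixes M :: "complex mat"
  assumes "M \<in> carrier_mat n n" "v \<in> carrier_vec n" "M *\<^sub>v v = c \<cdot>\<^sub>v v"
  shows "mat_of_cols n [v] * mat1 c = M * mat_of_cols n [v]"
  using assms mult_mat_of_cols[of M n n "[v]"] by (simp add: mat_of_cols_single_mult_mat1)

lemma mat_of_cols_nonzero:
  fixes v :: "'a :: zero vec"
  assumes "v \<in> carrier_vec n" "v \<noteq> 0\<^sub>v n"
  shows "mat_of_cols n (v # vs) \<noteq> 0\<^sub>m n (length (v # vs))"
proof
  assume "mat_of_cols n (v # vs) = 0\<^sub>m n (length (v # vs))"
  then have "col (mat_of_cols n (v # vs)) 0 = col (0\<^sub>m n (length (v # vs))) 0" by simp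
  then show False using assms by (simp add: col_mat_of_cols)
qed

definition joint_eigenvector ::
  "('g, 'm) monoid_scheme \<Rightarrow> nat \<Rightarrow> ('g \<Rightarrow> complex mat) \<Rightarrow> ('g \<Rightarrow> complex) \<Rightarrow> complex vec \<Rightarrow> bool" where
  "joint_eigenvector G n \<rho> \<chi> v \<longleftrightarrow>
     v \<in> carrier_vec n \<and> v \<noteq> 0\<^sub>v n \<and> (\<forall>g\<in>carrier G. \<rho> g *\<^sub>v v = \<chi> g \<cdot>\<^sub>v v)"

lemma joint_eigenvectorD:
  assumes "joint_eigenvector G n \<rho> \<chi> v"
  shows "v \<in> carrier_vec n" "v \<noteq> 0\<^sub>v n" "g \<in> carrier G \<Longrightarrow> \<rho> g *\<^sub>v v = \<chi> g \<cdot>\<^sub>v v"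
  using assms by (simp_all add: joint_eigenvector_def)

lemma (in group) irrep_equiv_of_joint_eigenvector:
  assumes \<sigma>: "is_irrep G n \<sigma>" and \<rho>: "is_rep G 1 \<rho>"
    and v: "joint_eigenvector G n \<sigma> (character_of G \<rho>) v"
  shows "equiv_rep G \<sigma> \<rho>"
proof (rule equiv_rep_sym, rule schur_lemma[OF is_rep_1_irrep[OF \<rho>] \<sigma>])
  have "mat_of_cols n [v] * \<rho> g = \<sigma> g * mat_of_cols n [v]" if g: "g \<in> carrier G" for g
    unfolding is_rep_1_eq_mat1[OF \<rho> g]
    by (intro mult_eigenvector_column is_rep_carrier[OF is_irrep_imp_is_rep[OF \<sigma>] g]
        joint_eigenvectorD[OF v] g)
  then show "intertwiner G 1 \<rho> n \<sigma> (mat_of_cols n [v])"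
    by (simp add: intertwiner_def carrier_matI)
  show "mat_of_cols n [v] \<noteq> 0\<^sub>m n 1"
    using mat_of_cols_nonzero[OF joint_eigenvectorD(1,2)[OF v], of "[]"] by simp
qed

subsection \<open>Representations of finite abelian groups\<close>

definition coefficient_functions ::
  "('g, 'm) monoid_scheme \<Rightarrow> nat \<Rightarrow> ('g \<Rightarrow> complex mat) \<Rightarrow> ('g \<Rightarrow> nat \<Rightarrow> complex) set" where
  "coefficient_functions G n \<rho> =
     {F. \<exists>v\<in>carrier_vec n. \<forall>g\<in>carrier G. \<forall>i. F g i = (if i < n then (\<rho> g *\<^sub>v v) $ i else 0)}"

lemma (in comm_group) translation_invariant_coefficient_functions:
  assumes \<rho>: "is_rep G n \<rho>"
  shows "translation_invariant (coefficient_functions G n \<rho>)"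
  unfolding translation_invariant_def
proof (intro conjI ballI allI)
  note carrier = is_rep_carrier[OF \<rho>]
  have dim [simp]: "dim_row (\<rho> a) = n" if "a \<in> carrier G" for a using carrier[OF that] by simp
  fix F assume "F \<in> coefficient_functions G n \<rho>"
  then obtain v where v: "v \<in> carrier_vec n"
    and F: "\<forall>a\<in>carrier G. \<forall>i. F a i = (if i < n then (\<rho> a *\<^sub>v v) $ i else 0)"
    unfolding coefficient_functions_def by blast
  show "(\<lambda>b i. c * F b i) \<in> coefficient_functions G n \<rho>" for c
    unfolding coefficient_functions_def using F v
    by (intro CollectI bexI[of _ "c \<cdot>\<^sub>v v"])
      (auto simp: mult_mat_vec[OF carrier] simp del: index_mult_mat_vec)
  show "(\<lambda>b i. F b i + F' b i) \<in> coefficient_functions G n \<rho>"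
    if "F' \<in> coefficient_functions G n \<rho>" for F'
  proof -
    from that obtain v' where "v' \<in> carrier_vec n"
      "\<forall>a\<in>carrier G. \<forall>i. F' a i = (if i < n then (\<rho> a *\<^sub>v v') $ i else 0)"
      unfolding coefficient_functions_def by blast
    then show ?thesis
      unfolding coefficient_functions_def using F v
      by (intro CollectI bexI[of _ "v + v'"])
        (auto simp: mult_add_distrib_mat_vec[OF carrier] simp del: index_mult_mat_vec)
  qed
  show "(\<lambda>b. F (a \<otimes> b)) \<in> coefficient_functions G n \<rho>" if a: "a \<in> carrier G" for a
  proof -
    have "\<rho> (a \<otimes> b) *\<^sub>v v = \<rho> b *\<^sub>v (\<rho> a *\<^sub>v v)" if b: "b \<in> carrier G" for b
      using is_rep_mult[OF \<rho> b a] assoc_mult_mat_vec[OF carrier[OF b] carrier[OF a] v]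
      by (simp add: m_comm[OF a b])
    then show ?thesis
      unfolding coefficient_functions_def using F a mult_mat_vec_carrier[OF carrier[OF a] v]
      by (intro CollectI bexI[of _ "\<rho> a *\<^sub>v v"]) auto
  qed
qed

lemma (in comm_group) joint_eigenvector_exists:
  assumes fin: "finite (carrier G)" and \<rho>: "is_rep G n \<rho>" and n: "n > 0"
  obtains v \<chi> where "\<chi> \<in> characters G" "joint_eigenvector G n \<rho> \<chi> v"
proof -
  define F where "F a i = (if i < n then (\<rho> a *\<^sub>v unit_vec n 0) $ i else 0)" for a i
  have F: "F \<in> coefficient_functions G n \<rho>"
    unfolding coefficient_functions_def F_def by (intro CollectI bexI[of _ "unit_vec n 0"]) auto
  have "F \<one> 0 \<noteq> 0" using n by (simp add: F_def is_rep_one[OF \<rho>])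
  then obtain H \<chi> j where H: "H \<in> coefficient_functions G n \<rho>" and \<chi>: "\<chi> \<in> characters G"
    and nonzero: "H \<one> j \<noteq> 0" and eval: "\<forall>a\<in>carrier G. \<forall>i. H a i = \<chi> a * H \<one> i"
    by (rule translation_invariant_character[OF fin
          translation_invariant_coefficient_functions[OF \<rho>] F one_closed])
  from H obtain v where v: "v \<in> carrier_vec n"
    and coeff: "\<forall>a\<in>carrier G. \<forall>i. H a i = (if i < n then (\<rho> a *\<^sub>v v) $ i else 0)"
    unfolding coefficient_functions_def by blast
  have H_one: "H \<one> i = (if i < n then v $ i else 0)" for i
    using v bspec[OF coeff one_closed] by (simp add: is_rep_one[OF \<rho>])
  have "joint_eigenvector G n \<rho> \<chi> v"
    unfolding joint_eigenvector_def
  proof (intro conjI v)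
    show "v \<noteq> 0\<^sub>v n" using nonzero by (auto simp: H_one split: if_splits)
    show "\<forall>a\<in>carrier G. \<rho> a *\<^sub>v v = \<chi> a \<cdot>\<^sub>v v"
    proof (intro ballI eq_vecI)
      fix a i assume a: "a \<in> carrier G" and "i < dim_vec (\<chi> a \<cdot>\<^sub>v v)"
      then have i: "i < n" using v by simp
      then have "(\<rho> a *\<^sub>v v) $ i = H a i" using bspec[OF coeff a] by simp
      also have "\<dots> = \<chi> a * v $ i" using bspec[OF eval a] H_one i by simp
      finally show "(\<rho> a *\<^sub>v v) $ i = (\<chi> a \<cdot>\<^sub>v v) $ i" using v i by simp
    qed (use is_rep_carrier[OF \<rho>] v in auto)
  qed
  then show thesis by (rule that[OF \<chi>])
qed

lemma (in comm_group) is_irrep_iff: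
  assumes fin: "finite (carrier G)"
  shows "is_irrep G n \<sigma> \<longleftrightarrow> n = 1 \<and> is_rep G 1 \<sigma>"
proof
  assume \<sigma>: "is_irrep G n \<sigma>"
  then have rep: "is_rep G n \<sigma>" and n: "n > 0" by (auto simp: is_irrep_def)
  obtain v \<chi> where \<chi>: "\<chi> \<in> characters G" and v: "joint_eigenvector G n \<sigma> \<chi> v"
    by (rule joint_eigenvector_exists[OF fin rep n])
  have "equiv_rep G \<sigma> (\<lambda>a. mat1 (\<chi> a))"
    using irrep_equiv_of_joint_eigenvector[OF \<sigma> is_rep_mat1[OF \<chi>]] v
    by (simp add: character_of_mat1[OF \<chi>])
  then have "is_rep G n (\<lambda>a. mat1 (\<chi> a))" by (rule equiv_repD[OF _ rep])
  then show "n = 1 \<and> is_rep G 1 \<sigma>" using rep is_rep_mat1[OF \<chi>] is_rep_dim_unique by blast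
qed (use is_rep_1_irrep in blast)

lemma (in comm_group) irreps_eq:
  "finite (carrier G) \<Longrightarrow> irreps G = {\<rho>. is_rep G 1 \<rho> \<and> character_of G \<rho> \<in> characters G}"
  by (auto simp: irreps_def is_irrep_iff character_of_in_characters)

lemma (in comm_group) irreps_ker_not_containing_eq:
  assumes "finite (carrier G)" "B \<subseteq> carrier G"
  shows "irreps_ker_not_containing G B =
    {\<rho>. is_rep G 1 \<rho> \<and> character_of G \<rho> \<in> {\<chi> \<in> characters G. \<exists>b\<in>B. \<chi> b \<noteq> 1}}"
proof -
  have "\<rho> b = 1\<^sub>m 1 \<longleftrightarrow> character_of G \<rho> b = 1" if "is_rep G 1 \<rho>" "b \<in> carrier G" for \<rho> b
    using is_rep_1_eq_mat1[OF that] by (metis mat1_one entry1_mat1)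
  then show ?thesis
    using assms
    by (auto simp: irreps_ker_not_containing_def is_irrep_iff kernel_def character_of_in_characters)
qed

lemma (in comm_group) enumerates_irreps_exists:
  assumes fin: "finite (carrier G)"
  shows "\<exists>\<rho>. enumerates_reps G (irreps G) (Coset.order G) \<rho>"
proof -
  obtain \<chi> where \<chi>: "bij_betw \<chi> {1..Coset.order G} (characters G)"
    using finite_same_card_bij[of "{1..Coset.order G}" "characters G"] finite_characters[OF fin]
    by (auto simp: card_characters[OF fin])
  then have "bij_betw (\<lambda>j. character_of G (\<lambda>g. mat1 (\<chi> j g))) {1..Coset.order G} (characters G)"
    using bij_betwE[OF \<chi>] by (subst bij_betw_cong[of _ _ \<chi>]) (auto simp: character_of_mat1)
  moreover have "is_rep G 1 (\<lambda>g. mat1 (\<chi> j g))" if "j \<in> {1..Coset.order G}" for j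
    using bij_betwE[OF \<chi>] that by (intro is_rep_mat1) blast
  ultimately show ?thesis
    unfolding irreps_eq[OF fin]
    by (intro exI[of _ "\<lambda>j g. mat1 (\<chi> j g)"]
        enumerates_one_dimensional_reps_iff[OF subset_refl, THEN iffD2]) blast
qed

section \<open>Characters of quotient groups\<close>

context normal
begin

lemma inflation_character:
  assumes \<chi>: "\<chi> \<in> characters (G Mod H)"
  shows "(\<lambda>a\<in>carrier G. \<chi> (H #> a)) \<in> characters G"
  using hom_compose[OF r_coset_hom_Mod, of \<chi> "mult_of class_ring"] \<chi>
  by (simp add: characters_def compose_def)

lemma inflation_trivial:
  assumes \<chi>: "\<chi> \<in> characters (G Mod H)" and "h \<in> H"
  shows "\<chi> (H #> h) = 1"
  using group.character_one[OF factorgroup_is_group \<chi>] coset_join2[OF _ subgroup_axioms] assms(2)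
  by simp

lemma trivial_character_factors:
  assumes \<chi>: "\<chi> \<in> characters G" and trivial: "\<And>h. h \<in> H \<Longrightarrow> \<chi> h = 1"
  obtains \<psi> where "\<psi> \<in> characters (G Mod H)" "\<chi> = (\<lambda>a\<in>carrier G. \<psi> (H #> a))"
proof -
  have hom: "\<chi> \<in> hom G (mult_of class_ring)" using \<chi> by (simp add: characters_def)
  have coset_invariant: "\<chi> a = \<chi> b"
    if a: "a \<in> carrier G" and b: "b \<in> carrier G" and eq: "H #> a = H #> b" for a b
  proof -
    have "a \<in> H #> b" using rcos_self[OF a subgroup_axioms] eq by simp
    then obtain h where "h \<in> H" "a = h \<otimes> b" by (auto simp: r_coset_def)
    then show ?thesis using b by (simp add: character_mult[OF \<chi>] trivial)
  qed
  obtain \<psi> where \<psi>: "\<psi> \<in> hom (G Mod H) (mult_of class_ring)"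
    and eval: "\<And>a. a \<in> carrier G \<Longrightarrow> \<psi> (H #> a) = \<chi> a"
    using FactGroup_universal[OF hom normal_axioms coset_invariant] by blast
  show thesis
  proof (rule that)
    show "restrict \<psi> (carrier (G Mod H)) \<in> characters (G Mod H)"
      using group.hom_restrict[OF factorgroup_is_group \<psi>] by (simp add: characters_def)
    show "\<chi> = (\<lambda>a\<in>carrier G. restrict \<psi> (carrier (G Mod H)) (H #> a))"
      using \<chi> eval by (intro extensionalityI) (auto simp: characters_def carrier_FactGroup)
  qed
qed

lemma bij_betw_inflation:
  "bij_betw (\<lambda>\<chi>. \<lambda>a\<in>carrier G. \<chi> (H #> a)) (characters (G Mod H)) {\<chi> \<in> characters G. \<forall>h\<in>H. \<chi> h = 1}"
  unfolding bij_betw_def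
proof
  show "inj_on (\<lambda>\<chi>. \<lambda>a\<in>carrier G. \<chi> (H #> a)) (characters (G Mod H))"
  proof (intro inj_onI character_eqI)
    fix \<chi> \<psi> C
    assume eq: "(\<lambda>a\<in>carrier G. \<chi> (H #> a)) = (\<lambda>a\<in>carrier G. \<psi> (H #> a))"
      and "C \<in> carrier (G Mod H)"
    then obtain a where "a \<in> carrier G" "C = H #> a" by (auto simp: carrier_FactGroup)
    then show "\<chi> C = \<psi> C" using fun_cong[OF eq, of a] by simp
  qed
  show "(\<lambda>\<chi>. \<lambda>a\<in>carrier G. \<chi> (H #> a)) ` characters (G Mod H) = {\<chi> \<in> characters G. \<forall>h\<in>H. \<chi> h = 1}"
  proof (intro equalityI subsetI)
    fix \<chi> assume "\<chi> \<in> {\<chi> \<in> characters G. \<forall>h\<in>H. \<chi> h = 1}"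
    then obtain \<psi> where "\<psi> \<in> characters (G Mod H)" "\<chi> = (\<lambda>a\<in>carrier G. \<psi> (H #> a))"
      using trivial_character_factors[of \<chi>] by blast
    then show "\<chi> \<in> (\<lambda>\<chi>. \<lambda>a\<in>carrier G. \<chi> (H #> a)) ` characters (G Mod H)" by blast
  qed (auto simp: inflation_character inflation_trivial)
qed

end

section \<open>Homomorphisms out of presented groups\<close>

fun gword_eval :: "('b, 'n) monoid_scheme \<Rightarrow> ('s \<Rightarrow> 'b) \<Rightarrow> 's gword \<Rightarrow> 'b" where
  "gword_eval H \<phi> [] = \<one>\<^bsub>H\<^esub>"
| "gword_eval H \<phi> ((s, b) # w) = (if b then \<phi> s else inv\<^bsub>H\<^esub> \<phi> s) \<otimes>\<^bsub>H\<^esub> gword_eval H \<phi> w"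

definition pres_lift :: "('b, 'n) monoid_scheme \<Rightarrow> ('s \<Rightarrow> 'b) \<Rightarrow> 's gword set \<Rightarrow> 'b" where
  "pres_lift H \<phi> U = gword_eval H \<phi> (SOME w. w \<in> U)"

lemma Cons_in_gwords [simp]: "(s, b) # w \<in> gwords S \<longleftrightarrow> s \<in> S \<and> w \<in> gwords S"
  and Nil_in_gwords [simp]: "[] \<in> gwords S"
  and append_in_gwords [simp]: "v @ w \<in> gwords S \<longleftrightarrow> v \<in> gwords S \<and> w \<in> gwords S"
  by (auto simp: gwords_def)

lemma carrier_pres_group: "carrier (pres_group S R) = (\<lambda>w. pres_rel S R `` {w}) ` gwords S"
  by (auto simp: pres_group_def quotient_def)

lemma one_pres_group: "\<one>\<^bsub>pres_group S R\<^esub> = pres_rel S R `` {[]}"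
  by (simp add: pres_group_def)

lemma pres_gen_closed: "s \<in> S \<Longrightarrow> pres_gen S R s \<in> carrier (pres_group S R)"
  by (auto simp: carrier_pres_group pres_gen_def)

lemma pres_class_eqI: "(v, w) \<in> pres_rel S R \<Longrightarrow> pres_rel S R `` {v} = pres_rel S R `` {w}"
  by (rule equiv_class_eq[OF equiv_pres_rel])

lemma pres_class_inverse_letter:
  assumes "s \<in> S"
  shows "pres_rel S R `` {[(s, False)]} = inv\<^bsub>pres_group S R\<^esub> pres_gen S R s"
proof -
  interpret P: group "pres_group S R" by (rule group_pres_group)
  show ?thesis
  proof (rule P.inv_equality[symmetric])
    have "pres_rel S R `` {[(s, False)] @ [(s, True)]} = pres_rel S R `` {[]}"
      using pres_cancel[of "[]" S "[]" s False R] assms by (intro pres_class_eqI) simp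
    then show "pres_rel S R `` {[(s, False)]} \<otimes>\<^bsub>pres_group S R\<^esub> pres_gen S R s = \<one>\<^bsub>pres_group S R\<^esub>"
      using assms by (simp add: pres_gen_def pres_group_mult one_pres_group)
  qed (use assms in \<open>auto simp: carrier_pres_group pres_gen_def\<close>)
qed

lemma pres_class_eq_gword_eval:
  "w \<in> gwords S \<Longrightarrow> pres_rel S R `` {w} = gword_eval (pres_group S R) (pres_gen S R) w"
proof (induction w)
  case Nil
  then show ?case by (simp add: one_pres_group)
next
  case (Cons l w)
  obtain s b where l: "l = (s, b)" by (cases l)
  with Cons.prems have s: "s \<in> S" and w: "w \<in> gwords S" by auto
  have "pres_rel S R `` {l # w} = pres_rel S R `` {[(s, b)]} \<otimes>\<^bsub>pres_group S R\<^esub> pres_rel S R `` {w}"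
    using pres_group_mult[of "[(s, b)]" S w R] s w l by simp
  then show ?case
    using s l Cons.IH[OF w] by (cases b) (simp_all add: pres_gen_def pres_class_inverse_letter)
qed

lemma gword_eval_relator:
  assumes "r \<in> R" "r \<in> gwords S"
  shows "gword_eval (pres_group S R) (pres_gen S R) r = \<one>\<^bsub>pres_group S R\<^esub>"
  using pres_class_eqI[OF pres_relator[of "[]" S "[]" r R]] assms
  by (simp add: pres_class_eq_gword_eval[symmetric] one_pres_group)

lemma pres_group_induct [consumes 1, case_names one generator inverse]:
  assumes g: "g \<in> carrier (pres_group S R)"
    and one: "P \<one>\<^bsub>pres_group S R\<^esub>"
    and gen: "\<And>s g. s \<in> S \<Longrightarrow> P g \<Longrightarrow> P (pres_gen S R s \<otimes>\<^bsub>pres_group S R\<^esub> g)"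
    and inv: "\<And>s g. s \<in> S \<Longrightarrow> P g \<Longrightarrow> P (inv\<^bsub>pres_group S R\<^esub> pres_gen S R s \<otimes>\<^bsub>pres_group S R\<^esub> g)"
  shows "P g"
proof -
  have "P (gword_eval (pres_group S R) (pres_gen S R) w)" if "w \<in> gwords S" for w
    using that
  proof (induction w)
    case (Cons l w)
    then show ?case using gen inv by (cases l) auto
  qed (simp add: one)
  then show ?thesis using g by (auto simp: carrier_pres_group pres_class_eq_gword_eval)
qed

context group
begin

lemma gword_eval_closed:
  "\<phi> \<in> S \<rightarrow> carrier G \<Longrightarrow> w \<in> gwords S \<Longrightarrow> gword_eval G \<phi> w \<in> carrier G"
  by (induction w) (auto simp: Pi_iff)

lemma gword_eval_append:
  assumes \<phi>: "\<phi> \<in> S \<rightarrow> carrier G" and v: "v \<in> gwords S"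
  shows "u \<in> gwords S \<Longrightarrow> gword_eval G \<phi> (u @ v) = gword_eval G \<phi> u \<otimes> gword_eval G \<phi> v"
proof (induction u)
  case Nil
  then show ?case using gword_eval_closed[OF \<phi> v] by simp
next
  case (Cons l u)
  obtain s b where l: "l = (s, b)" by (cases l)
  have "\<phi> s \<in> carrier G" "u \<in> gwords S" using Cons.prems \<phi> l by auto
  then show ?case
    using Cons.IH l gword_eval_closed[OF \<phi> v] gword_eval_closed[OF \<phi>, of u] by (simp add: m_assoc)
qed

lemma gword_eval_pres_rel:
  assumes \<phi>: "\<phi> \<in> S \<rightarrow> carrier G" and R: "\<forall>r\<in>R. gword_eval G \<phi> r = \<one>"
    and vw: "(v, w) \<in> pres_rel S R"
  shows "gword_eval G \<phi> v = gword_eval G \<phi> w"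
  using vw
proof induction
  case (pres_cancel u v s b)
  then have "\<phi> s \<in> carrier G" using \<phi> by blast
  then have "gword_eval G \<phi> [(s, b), (s, \<not> b)] = \<one>" by (cases b) simp_all
  then show ?case
    using pres_cancel gword_eval_append[OF \<phi>, of "[(s, b), (s, \<not> b)] @ v" u]
      gword_eval_append[OF \<phi>, of v "[(s, b), (s, \<not> b)]"] gword_eval_append[OF \<phi>, of v u]
      gword_eval_closed[OF \<phi>]
    by simp
next
  case (pres_relator u v r)
  then show ?case
    using gword_eval_append[OF \<phi>, of "r @ v" u] gword_eval_append[OF \<phi>, of v r]
      gword_eval_append[OF \<phi>, of v u] gword_eval_closed[OF \<phi>] R
    by simp
qed auto

context
  fixes \<phi> :: "'s \<Rightarrow> 'a" and S :: "'s set" and R :: "'s gword set"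
  assumes \<phi>: "\<phi> \<in> S \<rightarrow> carrier G" and R: "\<forall>r\<in>R. gword_eval G \<phi> r = \<one>"
begin

lemma pres_lift_class:
  assumes "w \<in> gwords S"
  shows "pres_lift G \<phi> (pres_rel S R `` {w}) = gword_eval G \<phi> w"
proof -
  have "w \<in> pres_rel S R `` {w}" using assms by (auto intro: pres_refl)
  then have "(w, SOME u. u \<in> pres_rel S R `` {w}) \<in> pres_rel S R"
    by (metis Image_singleton_iff someI)
  then show ?thesis using gword_eval_pres_rel[OF \<phi> R] by (simp add: pres_lift_def)
qed

lemma pres_lift_gen:
  assumes "s \<in> S"
  shows "pres_lift G \<phi> (pres_gen S R s) = \<phi> s"
  using funcset_mem[OF \<phi> assms] assms by (simp add: pres_gen_def pres_lift_class)

lemma pres_lift_hom: "pres_lift G \<phi> \<in> hom (pres_group S R) G"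
proof (rule homI)
  fix U V assume "U \<in> carrier (pres_group S R)" "V \<in> carrier (pres_group S R)"
  then obtain u v where "u \<in> gwords S" "v \<in> gwords S"
    "U = pres_rel S R `` {u}" "V = pres_rel S R `` {v}" by (auto simp: carrier_pres_group)
  then show "pres_lift G \<phi> (U \<otimes>\<^bsub>pres_group S R\<^esub> V) = pres_lift G \<phi> U \<otimes> pres_lift G \<phi> V"
    by (simp add: pres_group_mult pres_lift_class gword_eval_append[OF \<phi>])
qed (auto simp: carrier_pres_group pres_lift_class gword_eval_closed[OF \<phi>])

end

lemma mult_inv_eq_one_iff:
  assumes "a \<in> carrier G" "b \<in> carrier G"
  shows "a \<otimes> inv b = \<one> \<longleftrightarrow> a = b"
  using inv_solve_right[of \<one> a b] assms by auto

lemma gword_eval_product_relator: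
  assumes "\<phi> s \<in> carrier G" "\<phi> t \<in> carrier G" "\<phi> r \<in> carrier G"
  shows "gword_eval G \<phi> [(s, True), (t, True), (r, False)] = \<one> \<longleftrightarrow> \<phi> s \<otimes> \<phi> t = \<phi> r"
  using assms mult_inv_eq_one_iff[of "\<phi> s \<otimes> \<phi> t" "\<phi> r"] by (simp add: m_assoc)

lemma gword_eval_conjugation_relator:
  assumes "\<phi> s \<in> carrier G" "\<phi> t \<in> carrier G" "\<phi> r \<in> carrier G"
  shows "gword_eval G \<phi> [(s, True), (t, True), (s, False), (r, False)] = \<one> \<longleftrightarrow>
    \<phi> s \<otimes> \<phi> t = \<phi> r \<otimes> \<phi> s"
  using assms mult_inv_eq_one_iff[of "\<phi> s \<otimes> \<phi> t" "\<phi> r \<otimes> \<phi> s"]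
  by (simp add: m_assoc inv_mult_group)

end

section \<open>The extension by one generator\<close>

locale involutive_extension = comm_group A for A (structure) +
  fixes f :: "'a \<Rightarrow> 'a" and y :: 'a
  assumes f_hom: "f \<in> hom A A"
    and f_f: "a \<in> carrier A \<Longrightarrow> f (f a) = a"
    and y_closed [simp]: "y \<in> carrier A"
    and f_y [simp]: "f y = y"
begin

abbreviation E where "E \<equiv> ext_group A f y"
abbreviation \<iota> where "\<iota> \<equiv> ext_base A f y"
abbreviation x where "x \<equiv> ext_elem A f y"
abbreviation gen where "gen \<equiv> pres_gen (ext_letters A) (ext_relators A f y)"

sublocale E: group E
  unfolding ext_group_def by (rule group_pres_group)

sublocale f: group_hom A A f
  by unfold_locales (rule f_hom)

lemma ext_letters_cases:
  assumes "s \<in> ext_letters A"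
  obtains (Ext) "s = Ext" | (Base) a where "a \<in> carrier A" "s = Base a"
  using assms unfolding ext_letters_def by blast

lemma ext_relators_cases:
  assumes "r \<in> ext_relators A f y"
  obtains (product) a b where "a \<in> carrier A" "b \<in> carrier A"
      "r = [(Base a, True), (Base b, True), (Base (a \<otimes> b), False)]"
    | (square) "r = [(Ext, True), (Ext, True), (Base y, False)]"
    | (conjugation) a where "a \<in> carrier A"
      "r = [(Ext, True), (Base a, True), (Ext, False), (Base (f a), False)]"
  using assms unfolding ext_relators_def by blast

lemma gen_closed: "s \<in> ext_letters A \<Longrightarrow> gen s \<in> carrier E"
  unfolding ext_group_def by (rule pres_gen_closed)

lemma gen_Base: "gen (Base a) = \<iota> a"
  and gen_Ext: "gen Ext = x"
  by (simp_all add: ext_base_def ext_elem_def)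

lemma x_closed [simp]: "x \<in> carrier E"
  using gen_closed[of Ext] unfolding gen_Ext by (simp add: ext_letters_def)

lemma \<iota>_closed: "a \<in> carrier A \<Longrightarrow> \<iota> a \<in> carrier E"
  using gen_closed[of "Base a"] unfolding gen_Base by (simp add: ext_letters_def)

lemmas E_induct [consumes 1, case_names one generator inverse] =
  pres_group_induct[where S = "ext_letters A" and R = "ext_relators A f y", folded ext_group_def]

lemma gword_eval_ext_relator: "r \<in> ext_relators A f y \<Longrightarrow> gword_eval E gen r = \<one>\<^bsub>E\<^esub>"
  unfolding ext_group_def
  by (rule gword_eval_relator) (auto elim!: ext_relators_cases simp: ext_letters_def)

sublocale \<iota>: group_hom A E \<iota>
proof unfold_locales
  show "\<iota> \<in> hom A E"
  proof (rule homI)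
    fix a b assume ab: "a \<in> carrier A" "b \<in> carrier A"
    then have "gword_eval E gen [(Base a, True), (Base b, True), (Base (a \<otimes> b), False)] = \<one>\<^bsub>E\<^esub>"
      by (intro gword_eval_ext_relator) (auto simp: ext_relators_def)
    then show "\<iota> (a \<otimes> b) = \<iota> a \<otimes>\<^bsub>E\<^esub> \<iota> b"
      using ab by (subst (asm) E.gword_eval_product_relator) (simp_all add: gen_Base \<iota>_closed)
  qed (rule \<iota>_closed)
qed

lemma x_x: "x \<otimes>\<^bsub>E\<^esub> x = \<iota> y"
proof -
  have "gword_eval E gen [(Ext, True), (Ext, True), (Base y, False)] = \<one>\<^bsub>E\<^esub>"
    by (intro gword_eval_ext_relator) (auto simp: ext_relators_def)
  then show ?thesis
    by (subst (asm) E.gword_eval_product_relator) (simp_all add: gen_Base gen_Ext)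
qed

lemma x_\<iota>:
  assumes "a \<in> carrier A"
  shows "x \<otimes>\<^bsub>E\<^esub> \<iota> a = \<iota> (f a) \<otimes>\<^bsub>E\<^esub> x"
proof -
  have "gword_eval E gen [(Ext, True), (Base a, True), (Ext, False), (Base (f a), False)] = \<one>\<^bsub>E\<^esub>"
    using assms by (intro gword_eval_ext_relator) (auto simp: ext_relators_def)
  then show ?thesis
    using assms by (subst (asm) E.gword_eval_conjugation_relator) (simp_all add: gen_Base gen_Ext)
qed

lemma \<iota>_x: "a \<in> carrier A \<Longrightarrow> \<iota> a \<otimes>\<^bsub>E\<^esub> x = x \<otimes>\<^bsub>E\<^esub> \<iota> (f a)"
  by (simp add: x_\<iota> f_f)

lemma x_inv: "inv\<^bsub>E\<^esub> x = \<iota> (inv y) \<otimes>\<^bsub>E\<^esub> x"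
proof (rule E.inv_equality)
  have "\<iota> (inv y) \<otimes>\<^bsub>E\<^esub> \<iota> y = \<one>\<^bsub>E\<^esub>" using \<iota>.hom_mult[of "inv y" y] by simp
  then show "\<iota> (inv y) \<otimes>\<^bsub>E\<^esub> x \<otimes>\<^bsub>E\<^esub> x = \<one>\<^bsub>E\<^esub>" by (simp add: E.m_assoc x_x del: \<iota>.hom_inv)
qed simp_all

definition normal_forms :: "'a ext_letter gword set set" where
  "normal_forms = \<iota> ` carrier A \<union> (\<lambda>a. x \<otimes>\<^bsub>E\<^esub> \<iota> a) ` carrier A"

lemma \<iota>_normal_form:
  assumes b: "b \<in> carrier A" and g: "g \<in> normal_forms"
  shows "\<iota> b \<otimes>\<^bsub>E\<^esub> g \<in> normal_forms"
proof -
  from g consider (base) a where "a \<in> carrier A" "g = \<iota> a"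
    | (coset) a where "a \<in> carrier A" "g = x \<otimes>\<^bsub>E\<^esub> \<iota> a"
    unfolding normal_forms_def by blast
  then show ?thesis
  proof cases
    case (base a)
    then have "\<iota> b \<otimes>\<^bsub>E\<^esub> g = \<iota> (b \<otimes> a)" using b by simp
    then show ?thesis using b base(1) by (simp add: normal_forms_def del: \<iota>.hom_mult)
  next
    case (coset a)
    then have "\<iota> b \<otimes>\<^bsub>E\<^esub> g = x \<otimes>\<^bsub>E\<^esub> \<iota> (f b \<otimes> a)"
      using b by (simp add: E.m_assoc[symmetric] \<iota>_x)
    then show ?thesis using b coset(1) by (simp add: normal_forms_def del: \<iota>.hom_mult)
  qed
qed

lemma x_normal_form:
  assumes g: "g \<in> normal_forms"
  shows "x \<otimes>\<^bsub>E\<^esub> g \<in> normal_forms"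
proof -
  have "x \<otimes>\<^bsub>E\<^esub> (x \<otimes>\<^bsub>E\<^esub> \<iota> a) = \<iota> (y \<otimes> a)" if "a \<in> carrier A" for a
    using that by (simp add: E.m_assoc[symmetric] x_x)
  then show ?thesis using g unfolding normal_forms_def by (auto simp del: \<iota>.hom_mult)
qed

lemma carrier_E: "carrier E = normal_forms"
proof (intro equalityI subsetI)
  fix g assume "g \<in> carrier E"
  then show "g \<in> normal_forms"
  proof (induction rule: E_induct)
    case one
    show ?case using \<iota>.hom_one unfolding normal_forms_def by (metis UnI1 imageI one_closed)
  next
    case (generator s g)
    then show ?case
      by (auto elim!: ext_letters_cases simp: gen_Base gen_Ext \<iota>_normal_form x_normal_form)
  next
    case (inverse s g)
    then have g: "g \<in> carrier E" by (auto simp: normal_forms_def)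
    from inverse(1) show ?case
    proof (cases rule: ext_letters_cases)
      case Ext
      then have "inv\<^bsub>E\<^esub> gen s \<otimes>\<^bsub>E\<^esub> g = \<iota> (inv y) \<otimes>\<^bsub>E\<^esub> (x \<otimes>\<^bsub>E\<^esub> g)"
        using g by (simp add: gen_Ext x_inv E.m_assoc del: \<iota>.hom_inv)
      then show ?thesis using inverse \<iota>_normal_form[of "inv y"] by (simp add: x_normal_form)
    next
      case (Base b)
      then show ?thesis using inverse \<iota>_normal_form[of "inv b"] by (simp add: gen_Base)
    qed
  qed
qed (auto simp: normal_forms_def)

lemma E_cases:
  assumes "g \<in> carrier E"
  obtains (base) a where "a \<in> carrier A" "g = \<iota> a"
    | (coset) a where "a \<in> carrier A" "g = x \<otimes>\<^bsub>E\<^esub> \<iota> a"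
  using assms unfolding carrier_E normal_forms_def by blast

end

definition ext_lift ::
  "('b, 'n) monoid_scheme \<Rightarrow> ('a \<Rightarrow> 'b) \<Rightarrow> 'b \<Rightarrow> 'a ext_letter gword set \<Rightarrow> 'b" where
  "ext_lift H \<alpha> z = pres_lift H (case_ext_letter \<alpha> z)"

context involutive_extension
begin

lemma ext_lift_universal:
  assumes "group H" and \<alpha>: "\<alpha> \<in> hom A H" and z: "z \<in> carrier H"
    and z_square: "z \<otimes>\<^bsub>H\<^esub> z = \<alpha> y"
    and comm: "\<And>a. a \<in> carrier A \<Longrightarrow> z \<otimes>\<^bsub>H\<^esub> \<alpha> a = \<alpha> (f a) \<otimes>\<^bsub>H\<^esub> z"
  shows "ext_lift H \<alpha> z \<in> hom E H"
    and "ext_lift H \<alpha> z x = z"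
    and "a \<in> carrier A \<Longrightarrow> ext_lift H \<alpha> z (\<iota> a) = \<alpha> a"
proof -
  interpret H: group H by fact
  let ?\<phi> = "case_ext_letter \<alpha> z"
  have \<alpha>_closed: "\<alpha> a \<in> carrier H" if "a \<in> carrier A" for a using hom_in_carrier[OF \<alpha> that] .
  have \<phi>: "?\<phi> \<in> ext_letters A \<rightarrow> carrier H"
    using z \<alpha>_closed by (auto simp: ext_letters_def)
  have relators: "\<forall>r\<in>ext_relators A f y. gword_eval H ?\<phi> r = \<one>\<^bsub>H\<^esub>"
  proof
    fix r assume "r \<in> ext_relators A f y"
    then show "gword_eval H ?\<phi> r = \<one>\<^bsub>H\<^esub>"
    proof (cases rule: ext_relators_cases)
      case (product a b)
      then show ?thesis
        using \<alpha>_closed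
        by (subst product(3), subst H.gword_eval_product_relator) (simp_all add: hom_mult[OF \<alpha>])
    next
      case square
      then show ?thesis
        using z \<alpha>_closed z_square by (subst square, subst H.gword_eval_product_relator) simp_all
    next
      case (conjugation a)
      then show ?thesis
        using z \<alpha>_closed comm
        by (subst conjugation(2), subst H.gword_eval_conjugation_relator) simp_all
    qed
  qed
  note lift = H.pres_lift_hom[OF \<phi> relators] H.pres_lift_gen[OF \<phi> relators]
  have letters: "Ext \<in> ext_letters A" "a \<in> carrier A \<Longrightarrow> Base a \<in> ext_letters A" for a
    by (simp_all add: ext_letters_def)
  show "ext_lift H \<alpha> z \<in> hom E H" using lift(1) by (simp add: ext_lift_def ext_group_def)
  show "ext_lift H \<alpha> z x = z"
    using lift(2)[OF letters(1)] by (simp add: ext_lift_def gen_Ext)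
  show "ext_lift H \<alpha> z (\<iota> a) = \<alpha> a" if "a \<in> carrier A"
    using lift(2)[OF letters(2)[OF that]] by (simp add: ext_lift_def gen_Base)
qed

lemma ext_lift_rep:
  assumes \<alpha>: "is_rep A n \<alpha>" and X: "X \<in> carrier_mat n n" "X * X = \<alpha> y"
    and comm: "\<And>a. a \<in> carrier A \<Longrightarrow> X * \<alpha> a = \<alpha> (f a) * X"
  shows "is_rep E n (ext_lift (GLC n) \<alpha> X)"
    and "ext_lift (GLC n) \<alpha> X x = X"
    and "a \<in> carrier A \<Longrightarrow> ext_lift (GLC n) \<alpha> X (\<iota> a) = \<alpha> a"
proof -
  have \<alpha>_hom: "\<alpha> \<in> hom A (GLC n)" using \<alpha> by (simp add: is_rep_def)
  then have "det (\<alpha> y) \<noteq> 0" using hom_in_carrier[of \<alpha> A "GLC n" y] by (simp add: carrier_GLC)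
  then have "X \<in> carrier (GLC n)" using X det_mult[OF X(1) X(1)] by (simp add: carrier_GLC)
  note lift = ext_lift_universal[OF group_GLC \<alpha>_hom this, unfolded mult_GLC, OF X(2) comm]
  show "is_rep E n (ext_lift (GLC n) \<alpha> X)" "ext_lift (GLC n) \<alpha> X x = X"
    using lift(1,2) by (simp_all add: is_rep_def)
  show "a \<in> carrier A \<Longrightarrow> ext_lift (GLC n) \<alpha> X (\<iota> a) = \<alpha> a" by (rule lift(3))
qed

lemma intertwiner_extI:
  assumes \<rho>: "is_rep E n \<rho>" and \<sigma>: "is_rep E m \<sigma>" and Q: "Q \<in> carrier_mat m n"
    and Q_\<iota>: "\<And>a. a \<in> carrier A \<Longrightarrow> Q * \<rho> (\<iota> a) = \<sigma> (\<iota> a) * Q"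
    and Q_x: "Q * \<rho> x = \<sigma> x * Q"
  shows "intertwiner E n \<rho> m \<sigma> Q"
  unfolding intertwiner_def
proof (intro conjI ballI Q)
  fix g assume "g \<in> carrier E"
  then show "Q * \<rho> g = \<sigma> g * Q"
  proof (cases rule: E_cases)
    case (base a)
    then show ?thesis using Q_\<iota> by simp
  next
    case (coset a)
    note \<rho>_carrier = is_rep_carrier[OF \<rho> x_closed] is_rep_carrier[OF \<rho> \<iota>_closed[OF coset(1)]]
    note \<sigma>_carrier = is_rep_carrier[OF \<sigma> x_closed] is_rep_carrier[OF \<sigma> \<iota>_closed[OF coset(1)]]
    have "Q * \<rho> g = (Q * \<rho> x) * \<rho> (\<iota> a)"
      using coset is_rep_mult[OF \<rho>] assoc_mult_mat[OF Q \<rho>_carrier] by simp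
    also have "\<dots> = \<sigma> x * (Q * \<rho> (\<iota> a))"
      using Q_x assoc_mult_mat[OF \<sigma>_carrier(1) Q \<rho>_carrier(2)] by simp
    also have "\<dots> = \<sigma> g * Q"
      using coset is_rep_mult[OF \<sigma>] Q_\<iota> assoc_mult_mat[OF \<sigma>_carrier Q] by simp
    finally show ?thesis .
  qed
qed

end

section \<open>Two-by-two matrices\<close>

abbreviation (input) mat2 :: "complex \<Rightarrow> complex \<Rightarrow> complex \<Rightarrow> complex \<Rightarrow> complex mat" where
  "mat2 a b c d \<equiv> mat_of_rows_list 2 [[a, b], [c, d]]"

lemma mat2_dim [simp]: "dim_row (mat2 a b c d) = 2" "dim_col (mat2 a b c d) = 2"
  by (simp_all add: mat_of_rows_list_def)

lemma mat2_carrier [simp]: "mat2 a b c d \<in> carrier_mat 2 2"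
  by (rule carrier_matI) simp_all

lemma mat2_index [simp]:
  "mat2 a b c d $$ (0, 0) = a" "mat2 a b c d $$ (0, Suc 0) = b"
  "mat2 a b c d $$ (Suc 0, 0) = c" "mat2 a b c d $$ (Suc 0, Suc 0) = d"
  by (simp_all add: mat_of_rows_list_def)

lemma index_mult_mat_inner_2:
  fixes M N :: "'a :: semiring_0 mat"
  assumes "M \<in> carrier_mat r 2" "N \<in> carrier_mat 2 c" "i < r" "j < c"
  shows "(M * N) $$ (i, j) = M $$ (i, 0) * N $$ (0, j) + M $$ (i, Suc 0) * N $$ (Suc 0, j)"
  using assms by (simp add: scalar_prod_def numeral_2_eq_2)

lemma mat2_mult:
  "mat2 a b c d * mat2 a' b' c' d' =
     mat2 (a * a' + b * c') (a * b' + b * d') (c * a' + d * c') (c * b' + d * d')"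
  by (intro eq_matI)
    (auto simp: less_2_cases_iff index_mult_mat_inner_2[where r = 2 and c = 2]
      simp del: index_mult_mat(1))

lemma mat2_one: "mat2 1 0 0 1 = 1\<^sub>m 2"
  by (intro eq_matI) (auto simp: less_2_cases_iff)

lemma vec2_eq_iff:
  fixes v w :: "'a vec"
  assumes "v \<in> carrier_vec 2" "w \<in> carrier_vec 2"
  shows "v = w \<longleftrightarrow> v $ 0 = w $ 0 \<and> v $ Suc 0 = w $ Suc 0"
  using assms by (auto intro!: eq_vecI simp: less_2_cases_iff)

lemma mat2_mult_vec:
  assumes "w \<in> carrier_vec 2"
  shows "mat2 a b c d *\<^sub>v w \<in> carrier_vec 2"
    and "(mat2 a b c d *\<^sub>v w) $ 0 = a * w $ 0 + b * w $ Suc 0"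
    and "(mat2 a b c d *\<^sub>v w) $ Suc 0 = c * w $ 0 + d * w $ Suc 0"
  using assms mult_mat_vec_carrier[OF mat2_carrier assms]
  by (simp_all add: mat_of_rows_list_def scalar_prod_def numeral_2_eq_2)

lemma mat_of_cols_pair_mult_mat2:
  assumes "v \<in> carrier_vec n" "w \<in> carrier_vec n"
  shows "mat_of_cols n [v, w] * mat2 a b c d = mat_of_cols n [a \<cdot>\<^sub>v v + c \<cdot>\<^sub>v w, b \<cdot>\<^sub>v v + d \<cdot>\<^sub>v w]"
  using assms mat_of_cols_carrier(1)[of n "[v, w]"]
  by (intro eq_matI)
    (auto simp: less_2_cases_iff mat_of_cols_index mult.commute numeral_2_eq_2[symmetric]
      index_mult_mat_inner_2[where r = n and c = 2] simp del: index_mult_mat(1))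

lemma subspace_mat2_diagonal_components:
  assumes W: "vec_subspace 2 W"
    and invariant: "\<And>w. w \<in> W \<Longrightarrow> mat2 a 0 0 d *\<^sub>v w \<in> W"
    and "a \<noteq> d" and w: "w \<in> W"
  shows "w $ 0 \<cdot>\<^sub>v unit_vec 2 0 \<in> W" and "w $ Suc 0 \<cdot>\<^sub>v unit_vec 2 (Suc 0) \<in> W"
proof -
  let ?shift = "\<lambda>c. mat2 a 0 0 d *\<^sub>v w + (- c) \<cdot>\<^sub>v w"
  have w_carrier: "w \<in> carrier_vec 2" using w subspace_carrier_vec[OF W] by blast
  have shift: "z \<cdot>\<^sub>v ?shift c \<in> W" for c z
    using subspace_smult_closed[OF W] subspace_add_closed[OF W] invariant[OF w] w by blast
  have "w $ 0 \<cdot>\<^sub>v unit_vec 2 0 = inverse (a - d) \<cdot>\<^sub>v ?shift d"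
    "w $ Suc 0 \<cdot>\<^sub>v unit_vec 2 (Suc 0) = inverse (d - a) \<cdot>\<^sub>v ?shift a"
    using w_carrier \<open>a \<noteq> d\<close> mat2_mult_vec[OF w_carrier]
    by (simp_all add: vec2_eq_iff field_simps del: index_mult_mat_vec)
  then show "w $ 0 \<cdot>\<^sub>v unit_vec 2 0 \<in> W" "w $ Suc 0 \<cdot>\<^sub>v unit_vec 2 (Suc 0) \<in> W"
    using shift by simp_all
qed

section \<open>The representations of the extension\<close>

context involutive_extension
begin

definition twist :: "('a \<Rightarrow> complex) \<Rightarrow> 'a \<Rightarrow> complex" where
  "twist \<chi> = (\<lambda>a\<in>carrier A. \<chi> (f a))"

lemma twist_character: "\<chi> \<in> characters A \<Longrightarrow> twist \<chi> \<in> characters A"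
  by (simp add: characters_iff twist_def)

lemma twist_twist: "\<chi> \<in> characters A \<Longrightarrow> twist (twist \<chi>) = \<chi>"
  by (intro extensionalityI[of _ "carrier A"]) (auto simp: twist_def f_f characters_def)

abbreviation base_eigenvector ::
  "nat \<Rightarrow> ('a ext_letter gword set \<Rightarrow> complex mat) \<Rightarrow> ('a \<Rightarrow> complex) \<Rightarrow> complex vec \<Rightarrow> bool" where
  "base_eigenvector n \<sigma> \<equiv> joint_eigenvector A n (\<lambda>a. \<sigma> (\<iota> a))"

definition linear_rep :: "('a \<Rightarrow> complex) \<Rightarrow> complex \<Rightarrow> 'a ext_letter gword set \<Rightarrow> complex mat" where
  "linear_rep \<chi> t = ext_lift (GLC 1) (\<lambda>a. mat1 (\<chi> a)) (mat1 t)"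

lemma linear_rep:
  assumes \<chi>: "\<chi> \<in> characters A" "twist \<chi> = \<chi>" and t: "t\<^sup>2 = \<chi> y"
  shows linear_rep_is_rep: "is_rep E 1 (linear_rep \<chi> t)"
    and linear_rep_x: "linear_rep \<chi> t x = mat1 t"
    and linear_rep_\<iota>: "a \<in> carrier A \<Longrightarrow> linear_rep \<chi> t (\<iota> a) = mat1 (\<chi> a)"
proof -
  have square: "mat1 t * mat1 t = mat1 (\<chi> y)" using t by (simp add: mat1_mult power2_eq_square)
  have comm: "mat1 t * mat1 (\<chi> a) = mat1 (\<chi> (f a)) * mat1 t" if "a \<in> carrier A" for a
    using fun_cong[OF \<chi>(2), of a] that by (simp add: twist_def mat1_mult mult.commute)
  note lift = ext_lift_rep[OF is_rep_mat1[OF \<chi>(1)] mat1_carrier square comm]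
  show "is_rep E 1 (linear_rep \<chi> t)" "linear_rep \<chi> t x = mat1 t"
    "a \<in> carrier A \<Longrightarrow> linear_rep \<chi> t (\<iota> a) = mat1 (\<chi> a)"
    unfolding linear_rep_def using lift by blast+
qed

lemma linear_rep_equivD:
  assumes \<chi>: "\<chi> \<in> characters A" "twist \<chi> = \<chi>" "t\<^sup>2 = \<chi> y"
    and \<psi>: "\<psi> \<in> characters A" "twist \<psi> = \<psi>" "u\<^sup>2 = \<psi> y"
    and equiv: "equiv_rep E (linear_rep \<chi> t) (linear_rep \<psi> u)"
  shows "\<chi> = \<psi>" and "t = u"
proof -
  have eq: "entry1 (linear_rep \<chi> t g) = entry1 (linear_rep \<psi> u g)" if "g \<in> carrier E" for g
    using equiv that E.equiv_rep_1_iff[OF linear_rep_is_rep[OF \<chi>]]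
    by (metis character_of_def restrict_apply')
  show "\<chi> = \<psi>"
  proof (rule character_eqI[OF \<chi>(1) \<psi>(1)])
    fix a assume "a \<in> carrier A"
    then show "\<chi> a = \<psi> a" using eq[of "\<iota> a"] by (simp add: linear_rep_\<iota>[OF \<chi>] linear_rep_\<iota>[OF \<psi>])
  qed
  show "t = u" using eq[OF x_closed] by (simp add: linear_rep_x[OF \<chi>] linear_rep_x[OF \<psi>])
qed

definition induced_rep :: "('a \<Rightarrow> complex) \<Rightarrow> 'a ext_letter gword set \<Rightarrow> complex mat" where
  "induced_rep \<chi> = ext_lift (GLC 2) (\<lambda>a. mat2 (\<chi> a) 0 0 (\<chi> (f a))) (mat2 0 (\<chi> y) 1 0)"

lemma induced_rep:
  assumes \<chi>: "\<chi> \<in> characters A"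
  shows induced_rep_is_rep: "is_rep E 2 (induced_rep \<chi>)"
    and induced_rep_x: "induced_rep \<chi> x = mat2 0 (\<chi> y) 1 0"
    and induced_rep_\<iota>: "a \<in> carrier A \<Longrightarrow> induced_rep \<chi> (\<iota> a) = mat2 (\<chi> a) 0 0 (\<chi> (f a))"
proof -
  have rep: "is_rep A 2 (\<lambda>a. mat2 (\<chi> a) 0 0 (\<chi> (f a)))"
    by (rule is_repI) (simp_all add: character_one[OF \<chi>] character_mult[OF \<chi>] mat2_mult mat2_one)
  have square: "mat2 0 (\<chi> y) 1 0 * mat2 0 (\<chi> y) 1 0 = mat2 (\<chi> y) 0 0 (\<chi> (f y))"
    by (simp add: mat2_mult)
  have comm: "mat2 0 (\<chi> y) 1 0 * mat2 (\<chi> a) 0 0 (\<chi> (f a)) =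
      mat2 (\<chi> (f a)) 0 0 (\<chi> (f (f a))) * mat2 0 (\<chi> y) 1 0" if "a \<in> carrier A" for a
    using that by (simp add: mat2_mult f_f mult.commute)
  note lift = ext_lift_rep[OF rep mat2_carrier square comm]
  show "is_rep E 2 (induced_rep \<chi>)" "induced_rep \<chi> x = mat2 0 (\<chi> y) 1 0"
    "a \<in> carrier A \<Longrightarrow> induced_rep \<chi> (\<iota> a) = mat2 (\<chi> a) 0 0 (\<chi> (f a))"
    unfolding induced_rep_def using lift by blast+
qed

lemma induced_rep_x_\<iota>:
  assumes \<chi>: "\<chi> \<in> characters A" and a: "a \<in> carrier A"
  shows "induced_rep \<chi> (x \<otimes>\<^bsub>E\<^esub> \<iota> a) = mat2 0 (\<chi> (y \<otimes> f a)) (\<chi> a) 0"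
  using a is_rep_mult[OF induced_rep_is_rep[OF \<chi>] x_closed \<iota>_closed[OF a]]
  by (simp add: induced_rep_x[OF \<chi>] induced_rep_\<iota>[OF \<chi>] mat2_mult character_mult[OF \<chi>])

lemma induced_rep_irrep:
  assumes \<chi>: "\<chi> \<in> characters A" "twist \<chi> \<noteq> \<chi>"
  shows "is_irrep E 2 (induced_rep \<chi>)"
proof (rule is_irrepI[OF induced_rep_is_rep[OF \<chi>(1)]])
  let ?e\<^sub>0 = "unit_vec 2 0 :: complex vec" and ?e\<^sub>1 = "unit_vec 2 (Suc 0) :: complex vec"
  fix W w assume W: "invariant_subspace E 2 (induced_rep \<chi>) W"
    and w: "w \<in> W" "w \<in> carrier_vec 2" "w \<noteq> 0\<^sub>v 2"
  then have subspace: "vec_subspace 2 W"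
    and action: "\<And>g v. g \<in> carrier E \<Longrightarrow> v \<in> W \<Longrightarrow> induced_rep \<chi> g *\<^sub>v v \<in> W"
    by (auto simp: invariant_subspace_def)
  have span: "u \<in> W" if "c \<cdot>\<^sub>v u \<in> W" "c \<noteq> 0" for c :: complex and u
    using subspace_smult_closed[OF subspace that(1), of "inverse c"] that(2)
    by (simp add: smult_smult_assoc)
  obtain a where a: "a \<in> carrier A" "\<chi> a \<noteq> \<chi> (f a)"
    using \<chi> character_eqI[OF twist_character[OF \<chi>(1)] \<chi>(1)] by (force simp: twist_def)
  have components: "w $ 0 \<cdot>\<^sub>v ?e\<^sub>0 \<in> W" "w $ Suc 0 \<cdot>\<^sub>v ?e\<^sub>1 \<in> W"
    using subspace_mat2_diagonal_components[OF subspace _ a(2) w(1)] action[OF \<iota>_closed[OF a(1)]]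
    by (simp_all add: induced_rep_\<iota>[OF \<chi>(1) a(1)])
  have "induced_rep \<chi> x *\<^sub>v ?e\<^sub>0 = ?e\<^sub>1" "induced_rep \<chi> x *\<^sub>v ?e\<^sub>1 = \<chi> y \<cdot>\<^sub>v ?e\<^sub>0"
    by (simp_all add: induced_rep_x[OF \<chi>(1)] vec2_eq_iff mat2_mult_vec del: index_mult_mat_vec)
  then have swap: "?e\<^sub>0 \<in> W \<longleftrightarrow> ?e\<^sub>1 \<in> W"
    using action[OF x_closed] span[of "\<chi> y" ?e\<^sub>0] character_nonzero[OF \<chi>(1) y_closed] by metis
  have "w $ 0 \<noteq> 0 \<or> w $ Suc 0 \<noteq> 0" using w(2,3) by (auto simp: vec2_eq_iff)
  then have "?e\<^sub>0 \<in> W \<and> ?e\<^sub>1 \<in> W"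
    using span[OF components(1)] span[OF components(2)] swap by blast
  then show "W = carrier_vec 2"
    by (intro subspace_eq_carrier_vec[OF subspace]) (auto simp: less_2_cases_iff)
qed simp

lemma induced_rep_base_eigenvector:
  assumes \<chi>: "\<chi> \<in> characters A" and \<psi>: "\<psi> \<in> characters A"
    and v: "base_eigenvector 2 (induced_rep \<chi>) \<psi> v"
  shows "\<psi> = \<chi> \<or> \<psi> = twist \<chi>"
proof -
  have "mat2 (\<chi> a) 0 0 (\<chi> (f a)) *\<^sub>v v = \<psi> a \<cdot>\<^sub>v v" if "a \<in> carrier A" for a
    using joint_eigenvectorD(3)[OF v that] by (simp add: induced_rep_\<iota>[OF \<chi> that])
  then have eigen: "\<chi> a * v $ 0 = \<psi> a * v $ 0" "\<chi> (f a) * v $ Suc 0 = \<psi> a * v $ Suc 0"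
    if "a \<in> carrier A" for a
    using that joint_eigenvectorD(1)[OF v]
    by (simp_all add: vec2_eq_iff mat2_mult_vec del: index_mult_mat_vec)
  consider (first) "v $ 0 \<noteq> 0" | (second) "v $ Suc 0 \<noteq> 0"
    using joint_eigenvectorD(1,2)[OF v] by (auto simp: vec2_eq_iff)
  then show ?thesis
  proof cases
    case first
    then have "\<psi> = \<chi>" using eigen(1) by (intro character_eqI[OF \<psi> \<chi>]) simp
    then show ?thesis ..
  next
    case second
    then have "\<psi> = twist \<chi>"
      using eigen(2) by (intro character_eqI[OF \<psi> twist_character[OF \<chi>]]) (simp add: twist_def)
    then show ?thesis ..
  qed
qed

lemma induced_rep_equivD:
  assumes \<chi>: "\<chi> \<in> characters A" and \<psi>: "\<psi> \<in> characters A"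
    and equiv: "equiv_rep E (induced_rep \<chi>) (induced_rep \<psi>)"
  shows "\<chi> = \<psi> \<or> \<chi> = twist \<psi>"
proof -
  let ?e\<^sub>0 = "unit_vec 2 0 :: complex vec"
  obtain P where P: "P \<in> carrier_mat 2 2" "det P \<noteq> 0"
    and comm: "\<forall>g\<in>carrier E. P * induced_rep \<chi> g = induced_rep \<psi> g * P"
    by (rule E.equiv_repD[OF equiv induced_rep_is_rep[OF \<chi>]])
  have nonzero: "P *\<^sub>v ?e\<^sub>0 \<noteq> 0\<^sub>v 2"
    using P det_0_iff_vec_prod_zero_field[OF P(1)] unit_vec_nonzero[of 0 2]
    by (metis unit_vec_carrier pos2)
  have "induced_rep \<psi> (\<iota> a) *\<^sub>v (P *\<^sub>v ?e\<^sub>0) = \<chi> a \<cdot>\<^sub>v (P *\<^sub>v ?e\<^sub>0)" if a: "a \<in> carrier A" for a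
  proof -
    have "induced_rep \<psi> (\<iota> a) *\<^sub>v (P *\<^sub>v ?e\<^sub>0) = P * induced_rep \<chi> (\<iota> a) *\<^sub>v ?e\<^sub>0"
      using P(1) comm a is_rep_carrier[OF induced_rep_is_rep[OF \<psi>] \<iota>_closed[OF a]]
      by (simp add: assoc_mult_mat_vec[of _ 2 2])
    also have "\<dots> = P *\<^sub>v (induced_rep \<chi> (\<iota> a) *\<^sub>v ?e\<^sub>0)"
      using P(1) is_rep_carrier[OF induced_rep_is_rep[OF \<chi>] \<iota>_closed[OF a]]
      by (intro assoc_mult_mat_vec[OF _ _ unit_vec_carrier])
    also have "induced_rep \<chi> (\<iota> a) *\<^sub>v ?e\<^sub>0 = \<chi> a \<cdot>\<^sub>v ?e\<^sub>0"
      using a by (simp add: induced_rep_\<iota>[OF \<chi>] vec2_eq_iff mat2_mult_vec del: index_mult_mat_vec)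
    finally show ?thesis using P(1) by (simp add: mult_mat_vec[of _ 2 2])
  qed
  then have "base_eigenvector 2 (induced_rep \<psi>) \<chi> (P *\<^sub>v ?e\<^sub>0)"
    using nonzero mult_mat_vec_carrier[OF P(1), of ?e\<^sub>0] by (simp add: joint_eigenvector_def)
  then show ?thesis by (rule induced_rep_base_eigenvector[OF \<psi> \<chi>])
qed

lemma not_equiv_linear_rep_induced_rep:
  assumes "\<chi> \<in> characters A" "twist \<chi> = \<chi>" "t\<^sup>2 = \<chi> y" "\<psi> \<in> characters A"
  shows "\<not> equiv_rep E (linear_rep \<chi> t) (induced_rep \<psi>)"
proof
  assume "equiv_rep E (linear_rep \<chi> t) (induced_rep \<psi>)"
  then have "is_rep E 1 (induced_rep \<psi>)"
    using E.equiv_rep_1_iff[OF linear_rep_is_rep[OF assms(1-3)]] by blast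
  then show False using E.is_rep_dim_unique[OF induced_rep_is_rep[OF assms(4)]] by force
qed

end

section \<open>Classification of the irreducible representations\<close>

context involutive_extension
begin

lemma base_eigenvector_x:
  assumes \<sigma>: "is_rep E n \<sigma>" and \<chi>: "\<chi> \<in> characters A"
    and v: "base_eigenvector n \<sigma> \<chi> v"
  shows "base_eigenvector n \<sigma> (twist \<chi>) (\<sigma> x *\<^sub>v v)"
    and "\<sigma> x *\<^sub>v (\<sigma> x *\<^sub>v v) = \<chi> y \<cdot>\<^sub>v v"
proof -
  note carrier = is_rep_carrier[OF \<sigma>]
  note v_carrier = joint_eigenvectorD(1)[OF v] and eigen = joint_eigenvectorD(3)[OF v]
  have action: "\<sigma> g *\<^sub>v (\<sigma> h *\<^sub>v v) = \<sigma> (g \<otimes>\<^bsub>E\<^esub> h) *\<^sub>v v" if "g \<in> carrier E" "h \<in> carrier E" for g h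
    using assoc_mult_mat_vec[OF carrier carrier v_carrier] is_rep_mult[OF \<sigma>] that by simp
  show square: "\<sigma> x *\<^sub>v (\<sigma> x *\<^sub>v v) = \<chi> y \<cdot>\<^sub>v v" by (simp add: action x_x eigen)
  have "\<sigma> x *\<^sub>v v \<noteq> 0\<^sub>v n"
  proof
    assume "\<sigma> x *\<^sub>v v = 0\<^sub>v n"
    then have "\<chi> y \<cdot>\<^sub>v v = 0\<^sub>v n" using square mult_mat_zero_vec[OF carrier[OF x_closed]] by simp
    then show False
      using joint_eigenvectorD(1,2)[OF v] character_nonzero[OF \<chi> y_closed]
      by (simp add: smult_vec_eq_zero_iff)
  qed
  moreover have "\<sigma> (\<iota> a) *\<^sub>v (\<sigma> x *\<^sub>v v) = twist \<chi> a \<cdot>\<^sub>v (\<sigma> x *\<^sub>v v)" if a: "a \<in> carrier A" for a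
  proof -
    have "\<sigma> (\<iota> a) *\<^sub>v (\<sigma> x *\<^sub>v v) = \<sigma> x *\<^sub>v (\<sigma> (\<iota> (f a)) *\<^sub>v v)"
      using a by (simp add: action \<iota>_x)
    then show ?thesis
      using a mult_mat_vec[OF carrier[OF x_closed] v_carrier] by (simp add: eigen twist_def)
  qed
  ultimately show "base_eigenvector n \<sigma> (twist \<chi>) (\<sigma> x *\<^sub>v v)"
    using carrier[OF x_closed] v_carrier by (simp add: joint_eigenvector_def)
qed

lemma irrep_equiv_linear_rep:
  assumes \<sigma>: "is_irrep E n \<sigma>" and \<chi>: "\<chi> \<in> characters A" "twist \<chi> = \<chi>" "t\<^sup>2 = \<chi> y"
    and v: "base_eigenvector n \<sigma> \<chi> v" and x_eigen: "\<sigma> x *\<^sub>v v = t \<cdot>\<^sub>v v"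
  shows "equiv_rep E \<sigma> (linear_rep \<chi> t)"
proof (rule equiv_rep_sym, rule E.schur_lemma[OF E.is_rep_1_irrep[OF linear_rep_is_rep[OF \<chi>]] \<sigma>])
  note v_carrier = joint_eigenvectorD(1)[OF v] and eigen = joint_eigenvectorD(3)[OF v]
  have rep: "is_rep E n \<sigma>" by (rule is_irrep_imp_is_rep[OF \<sigma>])
  have column: "mat_of_cols n [v] * mat1 c = \<sigma> g * mat_of_cols n [v]"
    if "g \<in> carrier E" "\<sigma> g *\<^sub>v v = c \<cdot>\<^sub>v v" for g c
    by (rule mult_eigenvector_column[OF is_rep_carrier[OF rep that(1)] v_carrier that(2)])
  show "intertwiner E 1 (linear_rep \<chi> t) n \<sigma> (mat_of_cols n [v])"
    by (intro intertwiner_extI[OF linear_rep_is_rep[OF \<chi>] rep])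
      (simp_all add: linear_rep_x[OF \<chi>] linear_rep_\<iota>[OF \<chi>] column eigen x_eigen carrier_matI)
  show "mat_of_cols n [v] \<noteq> 0\<^sub>m n 1"
    using mat_of_cols_nonzero[OF joint_eigenvectorD(1,2)[OF v], of "[]"] by simp
qed

text \<open>Since \<open>x\<close> satisfies \<open>x\<^sup>2 = t\<^sup>2\<close> on the span of \<open>v\<close> and \<open>x v\<close>, the vector \<open>x v + t v\<close> is
  an eigenvector of \<open>x\<close> with eigenvalue \<open>t\<close>, unless it vanishes.\<close>

lemma irrep_equiv_linear_rep_cases:
  assumes \<sigma>: "is_irrep E n \<sigma>" and \<chi>: "\<chi> \<in> characters A" "twist \<chi> = \<chi>" "t\<^sup>2 = \<chi> y"
    and v: "base_eigenvector n \<sigma> \<chi> v"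
  shows "equiv_rep E \<sigma> (linear_rep \<chi> t) \<or> equiv_rep E \<sigma> (linear_rep \<chi> (- t))"
proof -
  have rep: "is_rep E n \<sigma>" by (rule is_irrep_imp_is_rep[OF \<sigma>])
  note carrier = is_rep_carrier[OF rep]
  let ?xv = "\<sigma> x *\<^sub>v v"
  let ?u = "?xv + t \<cdot>\<^sub>v v"
  note v_carrier = joint_eigenvectorD(1)[OF v] and eigen = joint_eigenvectorD(3)[OF v]
  note xv = joint_eigenvectorD[OF base_eigenvector_x(1)[OF rep \<chi>(1) v, unfolded \<chi>(2)]]
  have action: "\<sigma> g *\<^sub>v ?u = \<sigma> g *\<^sub>v ?xv + t \<cdot>\<^sub>v (\<sigma> g *\<^sub>v v)" if "g \<in> carrier E" for g
    using mult_add_distrib_mat_vec[OF carrier[OF that] xv(1), of "t \<cdot>\<^sub>v v"]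
      mult_mat_vec[OF carrier[OF that] v_carrier] v_carrier by simp
  show ?thesis
  proof (cases "?u = 0\<^sub>v n")
    case True
    then have "?xv = (- t) \<cdot>\<^sub>v v" by (rule add_smult_vec_eq_zeroD[OF xv(1) v_carrier])
    then show ?thesis using irrep_equiv_linear_rep[OF \<sigma> \<chi>(1,2) _ v] \<chi>(3) by simp
  next
    case False
    have "\<sigma> (\<iota> a) *\<^sub>v ?u = \<chi> a \<cdot>\<^sub>v ?u" if "a \<in> carrier A" for a
      using action[of "\<iota> a"] that xv(1,3) v_carrier
      by (simp add: eigen smult_add_distrib_vec[of _ n] smult_smult_assoc mult.commute)
    then have "base_eigenvector n \<sigma> \<chi> ?u"
      using False xv(1) v_carrier by (simp add: joint_eigenvector_def)
    moreover have "\<sigma> x *\<^sub>v ?u = t \<cdot>\<^sub>v ?u"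
    proof -
      have "\<sigma> x *\<^sub>v ?u = t\<^sup>2 \<cdot>\<^sub>v v + t \<cdot>\<^sub>v ?xv"
        using action[OF x_closed] base_eigenvector_x(2)[OF rep \<chi>(1) v] \<chi>(3) by simp
      also have "\<dots> = t \<cdot>\<^sub>v ?u"
        using xv(1) v_carrier
        by (simp add: smult_add_distrib_vec[of _ n] comm_add_vec[of _ n] smult_smult_assoc
            power2_eq_square)
      finally show ?thesis .
    qed
    ultimately show ?thesis using irrep_equiv_linear_rep[OF \<sigma> \<chi>] by blast
  qed
qed

lemma irrep_equiv_induced_rep:
  assumes \<sigma>: "is_irrep E n \<sigma>" and \<chi>: "\<chi> \<in> characters A" "twist \<chi> \<noteq> \<chi>"
    and v: "base_eigenvector n \<sigma> \<chi> v"
  shows "equiv_rep E \<sigma> (induced_rep \<chi>)"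
proof (rule equiv_rep_sym, rule E.schur_lemma[OF induced_rep_irrep[OF \<chi>] \<sigma>])
  have rep: "is_rep E n \<sigma>" by (rule is_irrep_imp_is_rep[OF \<sigma>])
  let ?xv = "\<sigma> x *\<^sub>v v"
  let ?Q = "mat_of_cols n [v, ?xv]"
  note v_carrier = joint_eigenvectorD(1)[OF v] and eigen = joint_eigenvectorD(3)[OF v]
  note xv = joint_eigenvectorD[OF base_eigenvector_x(1)[OF rep \<chi>(1) v]]
  have zero_smult: "0 \<cdot>\<^sub>v w = 0\<^sub>v n" if "w \<in> carrier_vec n" for w :: "complex vec"
    using smult_vec_eq_zero_iff[OF that] by simp
  have columns: "\<sigma> g * ?Q = mat_of_cols n [\<sigma> g *\<^sub>v v, \<sigma> g *\<^sub>v ?xv]" if "g \<in> carrier E" for g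
    using mult_mat_of_cols[OF is_rep_carrier[OF rep that], of "[v, ?xv]"] v_carrier xv(1) by simp
  show "intertwiner E 2 (induced_rep \<chi>) n \<sigma> ?Q"
  proof (rule intertwiner_extI[OF induced_rep_is_rep[OF \<chi>(1)] rep])
    show "?Q * induced_rep \<chi> (\<iota> a) = \<sigma> (\<iota> a) * ?Q" if "a \<in> carrier A" for a
      using that xv v_carrier
      by (simp add: induced_rep_\<iota>[OF \<chi>(1)] columns mat_of_cols_pair_mult_mat2 eigen
          twist_def zero_smult)
    show "?Q * induced_rep \<chi> x = \<sigma> x * ?Q"
      using base_eigenvector_x(2)[OF rep \<chi>(1) v] v_carrier xv(1)
      by (simp add: induced_rep_x[OF \<chi>(1)] columns mat_of_cols_pair_mult_mat2 zero_smult)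
  qed (simp add: carrier_matI numeral_2_eq_2)
  show "?Q \<noteq> 0\<^sub>m n 2"
    using mat_of_cols_nonzero[OF joint_eigenvectorD(1,2)[OF v], of "[?xv]"]
    by (simp add: numeral_2_eq_2)
qed

end

locale finite_involutive_extension = involutive_extension +
  assumes finite_carrier: "finite (carrier A)"
begin

lemma irreps_E_cases:
  assumes "\<sigma> \<in> irreps E"
  obtains (linear) \<chi> where "\<chi> \<in> characters A" "twist \<chi> = \<chi>"
      "\<And>t. t\<^sup>2 = \<chi> y \<Longrightarrow> equiv_rep E \<sigma> (linear_rep \<chi> t) \<or> equiv_rep E \<sigma> (linear_rep \<chi> (- t))"
    | (induced) \<chi> where "\<chi> \<in> characters A" "twist \<chi> \<noteq> \<chi>"
      "equiv_rep E \<sigma> (induced_rep \<chi>)" "equiv_rep E \<sigma> (induced_rep (twist \<chi>))"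
proof -
  from assms obtain n where \<sigma>: "is_irrep E n \<sigma>" by (auto simp: irreps_def)
  then have rep: "is_rep E n \<sigma>" and n: "n > 0" by (auto simp: is_irrep_def)
  obtain v \<chi> where \<chi>: "\<chi> \<in> characters A" and v: "base_eigenvector n \<sigma> \<chi> v"
    by (rule joint_eigenvector_exists[OF finite_carrier is_rep_compose_hom[OF rep \<iota>.homh] n])
  show thesis
  proof (cases "twist \<chi> = \<chi>")
    case True
    then show ?thesis using linear irrep_equiv_linear_rep_cases[OF \<sigma> \<chi> True _ v] \<chi> by blast
  next
    case False
    then have "twist (twist \<chi>) \<noteq> twist \<chi>" using twist_twist[OF \<chi>] by metis
    then show ?thesis
      using induced \<chi> False irrep_equiv_induced_rep[OF \<sigma> \<chi> False v]
        irrep_equiv_induced_rep[OF \<sigma> twist_character[OF \<chi>] _ base_eigenvector_x(1)[OF rep \<chi> v]]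
      by blast
  qed
qed

end

locale enumerated_characters = finite_involutive_extension +
  fixes k m :: nat and p q :: "nat \<Rightarrow> 'a \<Rightarrow> complex" and s :: "nat \<Rightarrow> complex"
  assumes bij_p: "bij_betw p {1..k} {\<chi> \<in> characters A. twist \<chi> = \<chi>}"
    and s_square: "j \<in> {1..k} \<Longrightarrow> (s j)\<^sup>2 = p j y"
    and bij_q: "bij_betw q {1..2 * m} {\<chi> \<in> characters A. twist \<chi> \<noteq> \<chi>}"
    and q_twist: "j \<in> {1..m} \<Longrightarrow> q (j + m) = twist (q j)"
begin

definition ext_irrep :: "nat \<Rightarrow> 'a ext_letter gword set \<Rightarrow> complex mat" where
  "ext_irrep i =
     (if i \<le> k then linear_rep (p i) (s i)
      else if i \<le> 2 * k then linear_rep (p (i - k)) (- s (i - k))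
      else induced_rep (q (i - 2 * k)))"

lemma ext_irrep_plus: "j \<in> {1..k} \<Longrightarrow> ext_irrep j = linear_rep (p j) (s j)"
  and ext_irrep_minus: "j \<in> {1..k} \<Longrightarrow> ext_irrep (j + k) = linear_rep (p j) (- s j)"
  and ext_irrep_induced: "j \<in> {1..m} \<Longrightarrow> ext_irrep (2 * k + j) = induced_rep (q j)"
  by (auto simp: ext_irrep_def)

lemma index_cases:
  assumes "i \<in> {1..2 * k + m}"
  obtains (plus) "i \<in> {1..k}" | (minus) j where "j \<in> {1..k}" "i = j + k"
    | (induced) j where "j \<in> {1..m}" "i = 2 * k + j"
proof -
  consider (first) "i \<le> k" | (middle) "k < i" "i \<le> 2 * k" | (last) "2 * k < i" by linarith
  then show thesis
  proof cases
    case first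
    then show ?thesis using plus assms by simp
  next
    case middle
    then show ?thesis using minus[of "i - k"] by simp
  next
    case last
    then show ?thesis using induced[of "i - 2 * k"] assms by simp
  qed
qed

lemma p_linear:
  assumes "j \<in> {1..k}"
  shows "p j \<in> characters A" "twist (p j) = p j" "(s j)\<^sup>2 = p j y" "(- s j)\<^sup>2 = p j y"
  using bij_betwE[OF bij_p] s_square assms by auto

lemma s_nonzero: "j \<in> {1..k} \<Longrightarrow> s j \<noteq> 0"
  using p_linear(3)[of j] character_nonzero[OF p_linear(1) y_closed, of j] by auto

lemma q_character:
  assumes "j \<in> {1..m}"
  shows "q j \<in> characters A" "twist (q j) \<noteq> q j"
  using bij_betwE[OF bij_q] assms by auto

lemma ext_irrep_in_irreps:
  assumes "i \<in> {1..2 * k + m}"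
  shows "ext_irrep i \<in> irreps E"
  using assms
proof (cases rule: index_cases)
  case plus
  then show ?thesis
    using E.is_rep_1_irrep[OF linear_rep_is_rep[OF p_linear(1-3)]]
    by (auto simp: irreps_def ext_irrep_plus)
next
  case (minus j)
  then show ?thesis
    using E.is_rep_1_irrep[OF linear_rep_is_rep[OF p_linear(1,2,4)]]
    by (auto simp: irreps_def ext_irrep_minus)
next
  case (induced j)
  then show ?thesis
    using induced_rep_irrep[OF q_character] by (auto simp: irreps_def ext_irrep_induced)
qed

lemma linear_rep_p_equivD:
  assumes equiv: "equiv_rep E (linear_rep (p i) t) (linear_rep (p j) u)"
    and i: "i \<in> {1..k}" and j: "j \<in> {1..k}" and t: "t\<^sup>2 = p i y" and u: "u\<^sup>2 = p j y"
  shows "i = j \<and> t = u"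
proof -
  note eq = linear_rep_equivD[OF p_linear(1,2)[OF i] t p_linear(1,2)[OF j] u equiv]
  then show ?thesis using inj_onD[OF bij_betw_imp_inj_on[OF bij_p] eq(1) i j] by blast
qed

lemma induced_rep_q_equivD:
  assumes equiv: "equiv_rep E (induced_rep (q i)) (induced_rep (q j))"
    and i: "i \<in> {1..m}" and j: "j \<in> {1..m}"
  shows "i = j"
proof -
  have "q i = q j \<or> q i = q (j + m)"
    using induced_rep_equivD[OF q_character(1)[OF i] q_character(1)[OF j] equiv] q_twist[OF j]
    by simp
  moreover have "i \<in> {1..2 * m}" "j \<in> {1..2 * m}" "j + m \<in> {1..2 * m}" using i j by auto
  ultimately have "i = j \<or> i = j + m" using bij_betw_imp_inj_on[OF bij_q] by (metis inj_onD)
  then show ?thesis using i j by auto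
qed

lemma not_equiv_linear_rep_p_induced_rep_q:
  assumes i: "i \<in> {1..k}" and t: "t\<^sup>2 = p i y" and j: "j \<in> {1..m}"
  shows "\<not> equiv_rep E (linear_rep (p i) t) (induced_rep (q j))"
    and "\<not> equiv_rep E (induced_rep (q j)) (linear_rep (p i) t)"
  using not_equiv_linear_rep_induced_rep[OF p_linear(1,2)[OF i] t q_character(1)[OF j]] equiv_rep_sym
  by blast+

lemma ext_irrep_equivD:
  assumes i: "i \<in> {1..2 * k + m}" and j: "j \<in> {1..2 * k + m}"
    and equiv: "equiv_rep E (ext_irrep i) (ext_irrep j)"
  shows "i = j"
  using i j equiv
  by (elim index_cases)
    (auto simp: ext_irrep_plus ext_irrep_minus ext_irrep_induced not_equiv_linear_rep_p_induced_rep_q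
        p_linear s_nonzero simp del: atLeastAtMost_iff One_nat_def
      dest: linear_rep_p_equivD induced_rep_q_equivD)

lemma ext_irrep_complete:
  assumes "\<sigma> \<in> irreps E"
  shows "\<exists>i\<in>{1..2 * k + m}. equiv_rep E \<sigma> (ext_irrep i)"
  using assms
proof (cases rule: irreps_E_cases)
  case (linear \<chi>)
  then obtain j where j: "j \<in> {1..k}" "\<chi> = p j" using bij_betw_imp_surj_on[OF bij_p] by blast
  then consider "equiv_rep E \<sigma> (ext_irrep j)" | "equiv_rep E \<sigma> (ext_irrep (j + k))"
    using linear(3)[of "s j"] s_square by (auto simp: ext_irrep_plus ext_irrep_minus)
  moreover have "j \<in> {1..2 * k + m}" "j + k \<in> {1..2 * k + m}" using j(1) by auto
  ultimately show ?thesis by blast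
next
  case (induced \<chi>)
  then obtain j where j: "j \<in> {1..2 * m}" "\<chi> = q j" using bij_betw_imp_surj_on[OF bij_q] by blast
  obtain i where i: "i \<in> {1..m}" "q i = \<chi> \<or> q i = twist \<chi>"
  proof (cases "j \<le> m")
    case True
    then show ?thesis using that[of j] j by auto
  next
    case False
    then have "j - m \<in> {1..m}" using j(1) by auto
    moreover from this have "\<chi> = twist (q (j - m))" using j False q_twist[of "j - m"] by simp
    ultimately have "j - m \<in> {1..m}" "\<chi> = twist (q (j - m))" by blast+
    then show ?thesis using that[of "j - m"] twist_twist[OF q_character(1)] by metis
  qed
  then have "equiv_rep E \<sigma> (ext_irrep (2 * k + i))" using induced by (auto simp: ext_irrep_induced)
  moreover have "2 * k + i \<in> {1..2 * k + m}" using i(1) by auto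
  ultimately show ?thesis by blast
qed

theorem enumerates_ext_irrep: "enumerates_reps E (irreps E) (2 * k + m) ext_irrep"
  unfolding enumerates_reps_def using ext_irrep_in_irreps ext_irrep_equivD ext_irrep_complete
  by blast

lemma ext_irrep_one_dimensional:
  assumes j: "j \<in> {1..k}"
  shows "is_rep E 1 (ext_irrep j)" "ext_irrep j x = mat1 (s j)"
    "a \<in> carrier A \<Longrightarrow> ext_irrep j (\<iota> a) = mat1 (p j a)"
    "is_rep E 1 (ext_irrep (j + k))" "ext_irrep (j + k) x = mat1 (- s j)"
    "a \<in> carrier A \<Longrightarrow> ext_irrep (j + k) (\<iota> a) = mat1 (p j a)"
  using linear_rep[OF p_linear(1-3)[OF j]] linear_rep[OF p_linear(1,2,4)[OF j]]
  unfolding ext_irrep_plus[OF j] ext_irrep_minus[OF j] by blast+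

lemma ext_irrep_two_dimensional:
  assumes "j \<in> {1..m}" "a \<in> carrier A"
  shows "ext_irrep (2 * k + j) (\<iota> a) = mat2 (q j a) 0 0 (q j (f a))"
    and "ext_irrep (2 * k + j) (x \<otimes>\<^bsub>E\<^esub> \<iota> a) = mat2 0 (q j (y \<otimes> f a)) (q j a) 0"
  using assms q_character(1)[OF assms(1)]
  by (simp_all add: ext_irrep_induced induced_rep_\<iota> induced_rep_x_\<iota> del: f.hom_mult)

end

section \<open>Enumerating the characters moved by the involution\<close>

lemma involution_transversal:
  assumes "finite X" and closed: "\<And>z. z \<in> X \<Longrightarrow> \<tau> z \<in> X"
    and involution: "\<And>z. z \<in> X \<Longrightarrow> \<tau> (\<tau> z) = z" and no_fixpoint: "\<And>z. z \<in> X \<Longrightarrow> \<tau> z \<noteq> z"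
  obtains T where "inj_on \<tau> T" "T \<inter> \<tau> ` T = {}" "X = T \<union> \<tau> ` T"
proof -
  obtain e :: "'a \<Rightarrow> nat" where e: "inj_on e X"
    using finite_imp_inj_to_nat_seg[OF assms(1)] by blast
  let ?T = "{z \<in> X. e z < e (\<tau> z)}"
  have cover: "X = ?T \<union> \<tau> ` ?T"
  proof (intro equalityI subsetI)
    fix z assume z: "z \<in> X"
    show "z \<in> ?T \<union> \<tau> ` ?T"
    proof (cases "e z < e (\<tau> z)")
      case False
      have "e z \<noteq> e (\<tau> z)" using inj_onD[OF e _ z closed[OF z]] no_fixpoint[OF z] by metis
      then have "\<tau> z \<in> ?T" using z closed[OF z] involution[OF z] False by simp
      then show ?thesis using involution[OF z] by (intro UnI2 image_eqI[of z \<tau> "\<tau> z"]) simp_all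
    qed (use z in simp)
  qed (use closed in blast)
  have inj: "inj_on \<tau> ?T"
    using involution by (intro inj_on_inverseI[of _ \<tau>]) blast
  have "?T \<inter> \<tau> ` ?T = {}" using involution by auto
  from that[OF inj this cover] show thesis .
qed

lemma enumerate_fixpoint_free_involution:
  assumes "finite X" "\<And>z. z \<in> X \<Longrightarrow> \<tau> z \<in> X" "\<And>z. z \<in> X \<Longrightarrow> \<tau> (\<tau> z) = z" "\<And>z. z \<in> X \<Longrightarrow> \<tau> z \<noteq> z"
  obtains g m where "card X = 2 * m" "bij_betw g {1..2 * m} X" "\<forall>j\<in>{1..m}. g (j + m) = \<tau> (g j)"
proof -
  obtain T where inj: "inj_on \<tau> T" and disj: "T \<inter> \<tau> ` T = {}" and X: "X = T \<union> \<tau> ` T"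
    by (rule involution_transversal[OF assms])
  define m where "m = card T"
  have fin: "finite T" using assms(1) X by simp
  obtain h where h: "bij_betw h {1..m} T"
    using finite_same_card_bij[of "{1..m}" T] fin by (auto simp: m_def)
  define g where "g j = (if j \<le> m then h j else \<tau> (h (j - m)))" for j
  have "bij_betw g {1..m} T" using h by (subst bij_betw_cong[of _ _ h]) (auto simp: g_def)
  moreover have "bij_betw (\<tau> \<circ> (h \<circ> (\<lambda>j. j - m))) {m + 1..2 * m} (\<tau> ` T)"
  proof (intro bij_betw_trans)
    show "bij_betw (\<lambda>j. j - m) {m + 1..2 * m} {1..m}"
      by (rule bij_betwI[where g = "\<lambda>j. j + m"]) auto
  qed (use h inj in \<open>auto simp: bij_betw_def\<close>)
  then have "bij_betw g {m + 1..2 * m} (\<tau> ` T)"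
    by (subst bij_betw_cong[of _ _ "\<tau> \<circ> (h \<circ> (\<lambda>j. j - m))"]) (auto simp: g_def)
  ultimately have "bij_betw g ({1..m} \<union> {m + 1..2 * m}) X"
    unfolding X using disj by (rule bij_betw_combine)
  also have "{1..m} \<union> {m + 1..2 * m} = {1..2 * m}" by auto
  finally have bij: "bij_betw g {1..2 * m} X" .
  have "card X = 2 * m" using bij_betw_same_card[OF bij] by simp
  moreover have "\<forall>j\<in>{1..m}. g (j + m) = \<tau> (g j)" by (simp add: g_def)
  ultimately show thesis by (rule that[OF _ bij])
qed

context involutive_extension
begin

definition B :: "'a set" where "B = {f a \<otimes> inv a | a. a \<in> carrier A}"

lemma B_subset: "B \<subseteq> carrier A"
  by (auto simp: B_def)

lemma subgroup_B: "subgroup B A"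
proof
  show "\<one> \<in> B" by (auto simp: B_def intro!: exI[of _ \<one>])
  fix b assume "b \<in> B"
  then obtain a where a: "a \<in> carrier A" "b = f a \<otimes> inv a" by (auto simp: B_def)
  then show "inv b \<in> B" by (auto simp: B_def inv_mult intro!: exI[of _ "inv a"])
  fix b' assume "b' \<in> B"
  then obtain a' where "a' \<in> carrier A" "b' = f a' \<otimes> inv a'" by (auto simp: B_def)
  then show "b \<otimes> b' \<in> B"
    using a by (auto simp: B_def inv_mult m_ac intro!: exI[of _ "a \<otimes> a'"])
qed (rule B_subset)

sublocale B: normal B A
  by (rule subgroup_imp_normal[OF subgroup_B])

sublocale quotient: comm_group "A Mod B"
  by (rule abelian_FactGroup[OF subgroup_B])

lemma twist_eq_iff_trivial_on_B:
  assumes \<chi>: "\<chi> \<in> characters A"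
  shows "twist \<chi> = \<chi> \<longleftrightarrow> (\<forall>b\<in>B. \<chi> b = 1)"
proof -
  have "\<chi> (f a \<otimes> inv a) = 1 \<longleftrightarrow> twist \<chi> a = \<chi> a" if "a \<in> carrier A" for a
    using that character_nonzero[OF \<chi> that]
    by (simp add: character_mult[OF \<chi>] character_inv[OF \<chi>] twist_def field_simps)
  moreover have "twist \<chi> = \<chi> \<longleftrightarrow> (\<forall>a\<in>carrier A. twist \<chi> a = \<chi> a)"
    using character_eqI[OF twist_character[OF \<chi>] \<chi>] by auto
  ultimately show ?thesis unfolding B_def by auto
qed

end

context finite_involutive_extension
begin

lemma finite_quotient: "finite (carrier (A Mod B))"
  using finite_carrier by (simp add: carrier_FactGroup)

lemma trivial_on_B_characters:
  "{\<chi> \<in> characters A. \<forall>b\<in>B. \<chi> b = 1} = {\<chi> \<in> characters A. twist \<chi> = \<chi>}"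
  "{\<chi> \<in> characters A. \<exists>b\<in>B. \<chi> b \<noteq> 1} = {\<chi> \<in> characters A. twist \<chi> \<noteq> \<chi>}"
  using twist_eq_iff_trivial_on_B by auto

lemma card_twist_fixed_characters:
  "card {\<chi> \<in> characters A. twist \<chi> = \<chi>} = Coset.order (A Mod B)"
  using bij_betw_same_card[OF B.bij_betw_inflation] quotient.card_characters[OF finite_quotient]
  by (simp add: trivial_on_B_characters)

lemma card_twist_moved_characters:
  "card {\<chi> \<in> characters A. twist \<chi> \<noteq> \<chi>} = card (carrier A) - Coset.order (A Mod B)"
proof -
  have "{\<chi> \<in> characters A. twist \<chi> \<noteq> \<chi>} = characters A - {\<chi> \<in> characters A. twist \<chi> = \<chi>}" by auto
  then show ?thesis
    using card_Diff_subset[of "{\<chi> \<in> characters A. twist \<chi> = \<chi>}" "characters A"]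
      finite_characters[OF finite_carrier]
    by (simp add: card_twist_fixed_characters card_characters[OF finite_carrier] Coset.order_def[of A])
qed

lemma twist_moved_characters_enumeration:
  obtains q m where "card (carrier A) - Coset.order (A Mod B) = 2 * m"
    "bij_betw q {1..2 * m} {\<chi> \<in> characters A. twist \<chi> \<noteq> \<chi>}"
    "\<forall>j\<in>{1..m}. q (j + m) = twist (q j)"
proof -
  let ?X = "{\<chi> \<in> characters A. twist \<chi> \<noteq> \<chi>}"
  have "finite ?X" using finite_characters[OF finite_carrier] by simp
  moreover have "twist \<chi> \<in> ?X" "twist (twist \<chi>) = \<chi>" "twist \<chi> \<noteq> \<chi>" if "\<chi> \<in> ?X" for \<chi>
    using that twist_character[of \<chi>] twist_twist[of \<chi>] by auto
  ultimately obtain q m where "card ?X = 2 * m" "bij_betw q {1..2 * m} ?X"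
    "\<forall>j\<in>{1..m}. q (j + m) = twist (q j)"
    by (rule enumerate_fixpoint_free_involution)
  then show thesis using that[of m q] by (simp add: card_twist_moved_characters)
qed

lemma enumerates_irreps_ker_not_containing_B_iff:
  "enumerates_reps A (irreps_ker_not_containing A B) N \<psi> \<longleftrightarrow> (\<forall>j\<in>{1..N}. is_rep A 1 (\<psi> j)) \<and>
     bij_betw (\<lambda>j. character_of A (\<psi> j)) {1..N} {\<chi> \<in> characters A. twist \<chi> \<noteq> \<chi>}"
  unfolding irreps_ker_not_containing_eq[OF finite_carrier B_subset] trivial_on_B_characters
  by (rule enumerates_one_dimensional_reps_iff) blast

lemma irreps_ker_not_containing_B_enumeration:
  defines "N \<equiv> card (carrier A) - Coset.order (A Mod B)"
  shows "even N"
    and "\<exists>\<psi>. enumerates_reps A (irreps_ker_not_containing A B) N \<psi> \<and>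
      (\<forall>j\<in>{1..N div 2}. \<forall>a\<in>carrier A. \<psi> (j + N div 2) a = \<psi> j (f a))"
proof -
  obtain q m where N: "N = 2 * m" and q: "bij_betw q {1..2 * m} {\<chi> \<in> characters A. twist \<chi> \<noteq> \<chi>}"
    and q_twist: "\<forall>j\<in>{1..m}. q (j + m) = twist (q j)"
    unfolding N_def by (rule twist_moved_characters_enumeration)
  show "even N" by (simp add: N)
  have q_char: "q j \<in> characters A" if "j \<in> {1..N}" for j
    using bij_betwE[OF q] that by (simp add: N)
  have "bij_betw (\<lambda>j. character_of A (\<lambda>a. mat1 (q j a))) {1..N} {\<chi> \<in> characters A. twist \<chi> \<noteq> \<chi>}"
    using q q_char by (subst bij_betw_cong[of _ _ q]) (simp_all add: N character_of_mat1)
  then have "enumerates_reps A (irreps_ker_not_containing A B) N (\<lambda>j a. mat1 (q j a))"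
    unfolding enumerates_irreps_ker_not_containing_B_iff using is_rep_mat1[OF q_char] by blast
  moreover have "mat1 (q (j + m) a) = mat1 (q j (f a))" if "j \<in> {1..m}" "a \<in> carrier A" for j a
    using q_twist that by (simp add: twist_def)
  ultimately show "\<exists>\<psi>. enumerates_reps A (irreps_ker_not_containing A B) N \<psi> \<and>
      (\<forall>j\<in>{1..N div 2}. \<forall>a\<in>carrier A. \<psi> (j + N div 2) a = \<psi> j (f a))"
    by (auto simp: N)
qed

lemma enumerated_characters_of_reps:
  assumes \<pi>: "enumerates_reps (A Mod B) (irreps (A Mod B)) k \<pi>"
    and s: "\<forall>j\<in>{1..k}. (s j)\<^sup>2 = entry1 (\<pi> j (B #> y))"
    and \<psi>: "enumerates_reps A (irreps_ker_not_containing A B) (2 * m) \<psi>"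
    and \<psi>_f: "\<forall>j\<in>{1..m}. \<forall>a\<in>carrier A. \<psi> (j + m) a = \<psi> j (f a)"
  shows "enumerated_characters A f y k m
    (\<lambda>j. \<lambda>a\<in>carrier A. entry1 (\<pi> j (B #> a))) (\<lambda>j. character_of A (\<psi> j)) s"
proof unfold_locales
  have "bij_betw (\<lambda>j. character_of (A Mod B) (\<pi> j)) {1..k} (characters (A Mod B))"
    using \<pi> quotient.enumerates_one_dimensional_reps_iff[OF subset_refl]
    by (simp add: quotient.irreps_eq[OF finite_quotient])
  from bij_betw_trans[OF this B.bij_betw_inflation]
  have "bij_betw (\<lambda>j. \<lambda>a\<in>carrier A. character_of (A Mod B) (\<pi> j) (B #> a)) {1..k}
      {\<chi> \<in> characters A. twist \<chi> = \<chi>}"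
    by (simp add: comp_def trivial_on_B_characters)
  moreover have "(\<lambda>a\<in>carrier A. character_of (A Mod B) (\<pi> j) (B #> a)) =
      (\<lambda>a\<in>carrier A. entry1 (\<pi> j (B #> a)))" for j
    by (intro restrict_ext) (simp add: character_of_def carrier_FactGroup)
  ultimately show "bij_betw (\<lambda>j. \<lambda>a\<in>carrier A. entry1 (\<pi> j (B #> a))) {1..k}
      {\<chi> \<in> characters A. twist \<chi> = \<chi>}" by simp
  show "(s j)\<^sup>2 = (\<lambda>a\<in>carrier A. entry1 (\<pi> j (B #> a))) y" if "j \<in> {1..k}" for j
    using s that by simp
  show "bij_betw (\<lambda>j. character_of A (\<psi> j)) {1..2 * m} {\<chi> \<in> characters A. twist \<chi> \<noteq> \<chi>}"
    using \<psi> by (simp add: enumerates_irreps_ker_not_containing_B_iff)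
  show "character_of A (\<psi> (j + m)) = twist (character_of A (\<psi> j))" if "j \<in> {1..m}" for j
    using \<psi>_f that by (auto simp: character_of_def twist_def intro!: restrict_ext)
qed

theorem irreps_of_enumerations:
  assumes "enumerates_reps (A Mod B) (irreps (A Mod B)) k \<pi>"
    and "\<forall>j\<in>{1..k}. (s j)\<^sup>2 = entry1 (\<pi> j (B #> y))"
    and "enumerates_reps A (irreps_ker_not_containing A B) (2 * m) \<psi>"
    and "\<forall>j\<in>{1..m}. \<forall>a\<in>carrier A. \<psi> (j + m) a = \<psi> j (f a)"
  shows "\<exists>\<rho>. enumerates_reps E (irreps E) (2 * k + m) \<rho> \<and>
    (\<forall>j\<in>{1..k}. is_rep E 1 (\<rho> j) \<and> is_rep E 1 (\<rho> (j + k)) \<and>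
       \<rho> j x = mat1 (s j) \<and> \<rho> (j + k) x = mat1 (- s j) \<and>
       (\<forall>a\<in>carrier A. \<rho> j (\<iota> a) = mat1 (entry1 (\<pi> j (B #> a))) \<and>
          \<rho> (j + k) (\<iota> a) = mat1 (entry1 (\<pi> j (B #> a))))) \<and>
    (\<forall>j\<in>{1..m}. \<forall>a\<in>carrier A.
       \<rho> (2 * k + j) (\<iota> a) = mat2 (entry1 (\<psi> j a)) 0 0 (entry1 (\<psi> j (f a))) \<and>
       \<rho> (2 * k + j) (x \<otimes>\<^bsub>E\<^esub> \<iota> a) = mat2 0 (entry1 (\<psi> j (y \<otimes> f a))) (entry1 (\<psi> j a)) 0)"
proof -
  interpret C: enumerated_characters A f y k m
    "\<lambda>j. \<lambda>a\<in>carrier A. entry1 (\<pi> j (B #> a))" "\<lambda>j. character_of A (\<psi> j)" s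
    using assms by (rule enumerated_characters_of_reps)
  show ?thesis
    by (intro exI[of _ C.ext_irrep])
      (simp add: C.enumerates_ext_irrep C.ext_irrep_one_dimensional C.ext_irrep_two_dimensional
        character_of_apply del: atLeastAtMost_iff One_nat_def f.hom_mult)
qed

end

lemma (in group) AutoGroup_ord_2:
  assumes "f \<in> carrier (AutoGroup G)" "group.ord (AutoGroup G) f = 2"
  shows "f \<in> hom G G" and "a \<in> carrier G \<Longrightarrow> f (f a) = a"
proof -
  interpret Aut: group "AutoGroup G" by (rule AutoGroup)
  have f: "f \<in> auto G" using assms(1) by (simp add: AutoGroup_def)
  then show "f \<in> hom G G" by (simp add: auto_def)
  have "f \<otimes>\<^bsub>AutoGroup G\<^esub> f = \<one>\<^bsub>AutoGroup G\<^esub>"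
    using Aut.pow_ord_eq_1[OF assms(1)] assms by (simp add: numeral_2_eq_2)
  then have "compose (carrier G) f f = (\<lambda>a\<in>carrier G. a)"
    using f by (simp add: AutoGroup_def BijGroup_def auto_def)
  then show "f (f a) = a" if "a \<in> carrier G"
    using that by (metis compose_eq restrict_apply')
qed

theorem theorem3p4:
  fixes A :: "('a, 'm) monoid_scheme" and f :: "'a \<Rightarrow> 'a" and y :: 'a
    and G :: "'a ext_letter gword set monoid"
    and \<iota> :: "'a \<Rightarrow> 'a ext_letter gword set" and x :: "'a ext_letter gword set"
    and B :: "'a set" and k m :: nat
  assumes "comm_group A" and "finite (carrier A)" and "card (carrier A) \<ge> 3"
    and "f \<in> carrier (AutoGroup A)" and "group.ord (AutoGroup A) f = 2"
    and "y \<in> carrier A" and "f y = y"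
    and G_def: "G = ext_group A f y"
    and \<iota>_def: "\<iota> = ext_base A f y"
    and x_def: "x = ext_elem A f y"
    and B_def: "B = {f a \<otimes>\<^bsub>A\<^esub> inv\<^bsub>A\<^esub> a | a. a \<in> carrier A}"
    and k_def: "k = card (rcosets\<^bsub>A\<^esub> B)"
    and m_def: "m = (card (carrier A) - k) div 2"
  shows "even (card (carrier A) - k)
    \<and> (\<exists>\<rho>. enumerates_reps G (irreps G) (2 * k + m) \<rho>)
    \<and> (\<exists>\<pi>. enumerates_reps (A Mod B) (irreps (A Mod B)) k \<pi>)
    \<and> (\<exists>\<psi>. enumerates_reps A (irreps_ker_not_containing A B) (card (carrier A) - k) \<psi> \<and>
           (\<forall>j\<in>{1..m}. \<forall>a\<in>carrier A. \<psi> (j + m) a = \<psi> j (f a)))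
    \<and> (\<forall>\<pi> s \<psi>.
         enumerates_reps (A Mod B) (irreps (A Mod B)) k \<pi> \<longrightarrow>
         (\<forall>j\<in>{1..k}. (s j)\<^sup>2 = entry1 (\<pi> j (B #>\<^bsub>A\<^esub> y))) \<longrightarrow>
         enumerates_reps A (irreps_ker_not_containing A B) (card (carrier A) - k) \<psi> \<longrightarrow>
         (\<forall>j\<in>{1..m}. \<forall>a\<in>carrier A. \<psi> (j + m) a = \<psi> j (f a)) \<longrightarrow>
         (\<exists>\<rho>. enumerates_reps G (irreps G) (2 * k + m) \<rho> \<and>
            (\<forall>j\<in>{1..k}.
               is_rep G 1 (\<rho> j) \<and> is_rep G 1 (\<rho> (j + k)) \<and>
               \<rho> j x = mat1 (s j) \<and> \<rho> (j + k) x = mat1 (- s j) \<and>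
               (\<forall>a\<in>carrier A.
                  \<rho> j (\<iota> a) = mat1 (entry1 (\<pi> j (B #>\<^bsub>A\<^esub> a))) \<and>
                  \<rho> (j + k) (\<iota> a) = mat1 (entry1 (\<pi> j (B #>\<^bsub>A\<^esub> a))))) \<and>
            (\<forall>j\<in>{1..m}. \<forall>a\<in>carrier A.
               \<rho> (2 * k + j) (\<iota> a) =
                 mat_of_rows_list 2 [[entry1 (\<psi> j a), 0], [0, entry1 (\<psi> j (f a))]] \<and>
               \<rho> (2 * k + j) (x \<otimes>\<^bsub>G\<^esub> \<iota> a) =
                 mat_of_rows_list 2 [[0, entry1 (\<psi> j (y \<otimes>\<^bsub>A\<^esub> f a))], [entry1 (\<psi> j a), 0]])))"
proof -
  interpret comm_group A by fact
  interpret X: finite_involutive_extension A f y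
    using assms(2,6,7) AutoGroup_ord_2[OF assms(4,5)] by unfold_locales
  have B_eq: "B = X.B" unfolding B_def X.B_def ..
  have k_eq: "k = Coset.order (A Mod X.B)"
    by (simp add: k_def B_eq Coset.order_def FactGroup_def)
  have even: "even (card (carrier A) - k)"
    unfolding k_eq by (rule X.irreps_ker_not_containing_B_enumeration(1))
  then have card_diff: "card (carrier A) - k = 2 * m" by (simp add: m_def)
  note classification = X.irreps_of_enumerations[folded B_eq G_def \<iota>_def x_def, of k _ _ m]
  have ex_\<pi>: "\<exists>\<pi>. enumerates_reps (A Mod B) (irreps (A Mod B)) k \<pi>"
    unfolding B_eq k_eq by (rule X.quotient.enumerates_irreps_exists[OF X.finite_quotient])
  have ex_\<psi>: "\<exists>\<psi>. enumerates_reps A (irreps_ker_not_containing A B) (card (carrier A) - k) \<psi> \<and>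
           (\<forall>j\<in>{1..m}. \<forall>a\<in>carrier A. \<psi> (j + m) a = \<psi> j (f a))"
    unfolding m_def B_eq k_eq by (rule X.irreps_ker_not_containing_B_enumeration(2))
  from ex_\<pi> ex_\<psi> obtain \<pi> \<psi> where reps: "enumerates_reps (A Mod B) (irreps (A Mod B)) k \<pi>"
    "enumerates_reps A (irreps_ker_not_containing A B) (2 * m) \<psi>"
    "\<forall>j\<in>{1..m}. \<forall>a\<in>carrier A. \<psi> (j + m) a = \<psi> j (f a)" unfolding card_diff by blast
  have "\<forall>j\<in>{1..k}. (csqrt (entry1 (\<pi> j (B #>\<^bsub>A\<^esub> y))))\<^sup>2 = entry1 (\<pi> j (B #>\<^bsub>A\<^esub> y))" by simp
  from classification[OF reps(1) this reps(2,3)]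
  have ex_\<rho>: "\<exists>\<rho>. enumerates_reps G (irreps G) (2 * k + m) \<rho>" by (elim ex_forward conjunct1)
  show ?thesis
  proof (intro conjI allI impI even ex_\<pi> ex_\<psi> ex_\<rho>, goal_cases arbitrary_enumerations)
    case (arbitrary_enumerations \<pi> s \<psi>)
    then show ?case by (intro classification) (simp_all only: card_diff)
  qed
qed

end
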